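(* For every $n\ge0$, the element $q_{2^n}\in\pi^{C_2}_*\mathrm{BP}_{C_2}$ is a $v_{(n,n-1)}$-generator, i.e. its underlying class $q_{2^n}^{\Phi e}\in\mathrm{BP}_*$ is a $v_n$-generator and its geometric fixed points $q_{2^n}^{\Phi C_2}\in\pi_*\mathrm{BP}_{C_2}^{\Phi C_2}$ is a $v_{n-1}$-generator.
   Context: The prime is $2$. $\mathrm{BP}_{C_2}:=\mathrm{MU}_{C_2}\wedge_{\mathrm{MU}}\mathrm{BP}$, where $\mathrm{MU}_{C_2}$ is genuine $C_2$-equivariant complex cobordism. Let $e\in\pi^{C_2}_{-2}\mathrm{BP}_{C_2}$ be the Euler class of the complexified sign character, and let $[2]_{\mathrm{BP}}(x)=\sum_{i\ge1}p_ix^i$ be the $2$-series of the universal $2$-typical formal group law over $\mathrm{BP}_*$ (so $p_1=2$). There is a pullback square of rings $$\begin{array}{ccc}\pi^{C_2}_*\mathrm{BP}_{C_2}&\to&\mathrm{BP}_*[[e]]/([2]_{\mathrm{BP}}(e))\\ \downarrow&&\downarrow\\ \pi_*\mathrm{BP}_{C_2}^{\Phi C_2}=\mathrm{BP}_*[e^{\pm1},b_i]_{i\ge1}&\to&\big(\mathrm{BP}_*[[e]]/([2]_{\mathrm{BP}}(e))\big)[e^{-1}],\end{array}$$ whose upper right corner is $\pi_*^{C_2}$ of the Borel completion, and in which $b_i$ maps to the coefficient of $z^i$ in $e+_{\mathrm{BP}}z$. The element $q_i\in\pi^{C_2}_{2i-2}\mathrm{BP}_{C_2}$ ($i\ge1$)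 is the one whose image in the upper right corner is $p_i+p_{i+1}e+p_{i+2}e^2+\cdots$ and whose image in the lower left corner is given inductively by $q_1=0$, $q_{i+1}=e^{-1}(q_i-p_i)$. In particular $q_i=p_i+eq_{i+1}$ and $eq_1=0$. The map $(-)^{\Phi e}$ is restriction to the trivial group, $\pi^{C_2}_*\mathrm{BP}_{C_2}\to\mathrm{BP}_*$, and $(-)^{\Phi C_2}$ is the left vertical map. For a $\mathrm{BP}_*$-algebra $R$ and $0\le m<\infty$, $x\in R$ is a $v_m$-generator if $x\equiv\epsilon v_m\bmod(v_0,\dots,v_{m-1})$ for some unit $\epsilon$ (units of nonzero degree such as $e^{\pm1}$ are allowed), where $v_0=2$ and $v_1,v_2,\dots$ are the usual (e.g. Araki) generators of $\mathrm{BP}_*$; $x$ is a $v_{-1}$-generator if $x=0$. *)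

theory Defs
  imports
    "HOL-Library.Poly_Mapping"
    "HOL-Library.Product_Plus"
    "HOL-Computational_Algebra.Formal_Power_Series"
begin

section \<open>The ring \<open>BP\<^sub>*\<close> and its formal group law\<close>

typedef z2loc = "{r :: rat. odd (snd (quotient_of r))}"
  morphisms rat_of_z2 z2_of_rat
  by (rule exI [of _ 0]) simp

setup_lifting type_definition_z2loc

lemma odd_denominatorI:
  assumes "r = of_int a / of_int b" and "odd b"
  shows "odd (snd (quotient_of r))"
proof -
  obtain p q where pq: "quotient_of r = (p, q)" by fastforce
  have q: "q > 0" "coprime p q" "r = of_int p / of_int q"
    using quotient_of_denom_pos [OF pq] quotient_of_coprime [OF pq] quotient_of_div [OF pq]
    by auto
  from \<open>odd b\<close> have "b \<noteq> 0" by auto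
  have "(of_int p :: rat) * of_int b = of_int a * of_int q"
    using assms(1) q \<open>b \<noteq> 0\<close> by (simp add: field_simps)
  then have "p * b = a * q" by (metis of_int_eq_iff of_int_mult)
  then have "q dvd b" using q(2) by (metis coprime_commute coprime_dvd_mult_right_iff dvd_triv_right)
  then show ?thesis using \<open>odd b\<close> pq by (auto elim: dvd_trans)
qed

lemma odd_denominatorE:
  assumes "odd (snd (quotient_of r))"
  obtains a b where "r = of_int a / of_int b" and "odd b"
  using assms by (metis prod.collapse quotient_of_div)

instantiation z2loc :: idom
begin

lift_definition zero_z2loc :: z2loc is 0 by simp
lift_definition one_z2loc :: z2loc is 1 by simp

lift_definition plus_z2loc :: "z2loc \<Rightarrow> z2loc \<Rightarrow> z2loc" is "(+)"
proof -
  fix r s :: rat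
  assume "odd (snd (quotient_of r))" "odd (snd (quotient_of s))"
  then obtain a b c d where r: "r = of_int a / of_int b" "odd b" and s: "s = of_int c / of_int d" "odd d"
    by (metis odd_denominatorE)
  then have "b \<noteq> 0" "d \<noteq> 0" by auto
  then have "r + s = of_int (a * d + c * b) / of_int (b * d)"
    unfolding r(1) s(1) by (simp add: field_simps)
  then show "odd (snd (quotient_of (r + s)))"
    by (rule odd_denominatorI) (use r s in simp)
qed

lift_definition uminus_z2loc :: "z2loc \<Rightarrow> z2loc" is uminus
  by (erule odd_denominatorE, rule odd_denominatorI [of _ "- a" b for a b]) auto

lift_definition minus_z2loc :: "z2loc \<Rightarrow> z2loc \<Rightarrow> z2loc" is "(-)"
proof -
  fix r s :: rat
  assume "odd (snd (quotient_of r))" "odd (snd (quotient_of s))"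
  then obtain a b c d where r: "r = of_int a / of_int b" "odd b" and s: "s = of_int c / of_int d" "odd d"
    by (metis odd_denominatorE)
  then have "b \<noteq> 0" "d \<noteq> 0" by auto
  then have "r - s = of_int (a * d - c * b) / of_int (b * d)"
    unfolding r(1) s(1) by (simp add: field_simps)
  then show "odd (snd (quotient_of (r - s)))"
    by (rule odd_denominatorI) (use r s in simp)
qed

lift_definition times_z2loc :: "z2loc \<Rightarrow> z2loc \<Rightarrow> z2loc" is "(*)"
proof -
  fix r s :: rat
  assume "odd (snd (quotient_of r))" "odd (snd (quotient_of s))"
  then obtain a b c d where r: "r = of_int a / of_int b" "odd b" and s: "s = of_int c / of_int d" "odd d"
    by (metis odd_denominatorE)
  then have "r * s = of_int (a * c) / of_int (b * d)" by simp
  then show "odd (snd (quotient_of (r * s)))"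
    by (rule odd_denominatorI) (use r s in simp)
qed

instance
  by standard (transfer; simp add: algebra_simps)+

end

lemma rat_of_z2_0 [simp]: "rat_of_z2 0 = 0" and rat_of_z2_1 [simp]: "rat_of_z2 1 = 1"
  by (transfer; simp)+

lifting_update z2loc.lifting
lifting_forget z2loc.lifting
lifting_forget poly_mapping.lifting

text \<open>
  \<open>BP\<^sub>* = \<int>\<^sub>(\<^sub>2\<^sub>)[v\<^sub>1, v\<^sub>2, \<dots>]\<close> as a monoid algebra: the exponent of \<open>v\<^sub>i\<close> in a monomial \<open>m\<close>
  is the value of \<open>m\<close> at \<open>i - 1\<close>.
\<close>

type_synonym bp = "(nat \<Rightarrow>\<^sub>0 nat) \<Rightarrow>\<^sub>0 z2loc"
type_synonym bpq = "(nat \<Rightarrow>\<^sub>0 nat) \<Rightarrow>\<^sub>0 rat"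

definition bp_to_bpq :: "bp \<Rightarrow> bpq"
  where "bp_to_bpq = Poly_Mapping.map rat_of_z2"

definition v :: "nat \<Rightarrow> bp"
  where "v i = (if i = 0 then 2 else Poly_Mapping.single (Poly_Mapping.single (i - 1) 1) 1)"

text \<open>
  The \<open>v\<^sub>i\<close> are Araki's generators: the logarithm \<open>\<Sum> l\<^sub>n x^(2^n)\<close> of the universal 2-typical formal
  group law satisfies \<open>2 l\<^sub>n = \<Sum>i\<le>n. l\<^sub>i v\<^sub>n\<^sub>-\<^sub>i^(2^i)\<close> with \<open>v\<^sub>0 = 2\<close>, equivalently
  \<open>[2](x) = \<Sum>\<^sup>F v\<^sub>i x^(2^i)\<close>. For \<open>n > 0\<close> the term \<open>i = n\<close> is \<open>2^(2^n) l\<^sub>n\<close>; it is moved to the left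
  below.
\<close>

fun araki_l :: "nat \<Rightarrow> bpq"
  where "araki_l n = (if n = 0 then 1 else
    Poly_Mapping.single 0 (1 / (2 - 2 ^ 2 ^ n)) * (\<Sum>i<n. araki_l i * bp_to_bpq (v (n - i)) ^ 2 ^ i))"

declare araki_l.simps [simp del]

definition bp_log :: "bpq fps"
  where "bp_log = Abs_fps (\<lambda>k. if \<exists>n. k = 2 ^ n then araki_l (THE n. k = 2 ^ n) else 0)"

text \<open>
  The compositional inverse of the logarithm, by the usual recursion (the library's \<open>fps_inv\<close>
  requires a field of coefficients); see \<open>bp_exp_oo_bp_log\<close> below.
\<close>

fun bp_exp_coeff :: "nat \<Rightarrow> bpq"
  where "bp_exp_coeff n = (if n = 1 then 1 else 0) - (\<Sum>i<n. bp_exp_coeff i * fps_nth (bp_log ^ i) n)"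

declare bp_exp_coeff.simps [simp del]

definition bp_exp :: "bpq fps"
  where "bp_exp = Abs_fps bp_exp_coeff"

text \<open>
  Power series in two variables \<open>x, z\<close> are series in \<open>z\<close> whose coefficients are series in \<open>x\<close>.
  \<open>bp_log_sum\<close> is \<open>log x + log z\<close>, and \<open>bp_fgl_rat a b\<close> is the coefficient of \<open>x^a z^b\<close>
  in \<open>exp (log x + log z)\<close>; only the powers \<open>k \<le> a + b\<close> contribute to it.
\<close>

definition bp_log_sum :: "bpq fps fps"
  where "bp_log_sum = fps_const bp_log + Abs_fps (\<lambda>b. fps_const (fps_nth bp_log b))"

definition bp_fgl_rat :: "nat \<Rightarrow> nat \<Rightarrow> bpq"
  where "bp_fgl_rat a b =
    (\<Sum>k\<le>a + b. fps_nth bp_exp k * fps_nth (fps_nth (bp_log_sum ^ k) b) a)"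

text \<open>
  The universal 2-typical formal group law \<open>x +\<^sub>B\<^sub>P z\<close> over \<open>BP\<^sub>*\<close>. By the theorem of Araki and
  Hazewinkel the coefficients \<open>bp_fgl_rat a b\<close> lie in the image of the injection
  \<open>bp_to_bpq\<close>, so each has a unique preimage.
\<close>

definition bp_fgl :: "bp fps fps"
  where "bp_fgl = Abs_fps (\<lambda>b. Abs_fps (\<lambda>a. inv bp_to_bpq (bp_fgl_rat a b)))"

text \<open>The 2-series \<open>[2]\<^sub>B\<^sub>P(x) = x +\<^sub>B\<^sub>P x = \<Sum> p\<^sub>i x^i\<close>.\<close>

definition two_series :: "bp fps"
  where "two_series = Abs_fps (\<lambda>n. \<Sum>b\<le>n. fps_nth (fps_nth bp_fgl b) (n - b))"

definition p :: "nat \<Rightarrow> bp"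
  where "p i = fps_nth two_series i"

lemma lookup_bp_to_bpq:
  "Poly_Mapping.lookup (bp_to_bpq a) m = rat_of_z2 (Poly_Mapping.lookup a m)"
  by (simp add: bp_to_bpq_def Poly_Mapping.map.rep_eq when_def)

lemma inj_bp_to_bpq: "inj bp_to_bpq"
  by (rule injI, rule poly_mapping_eqI) (metis lookup_bp_to_bpq rat_of_z2_inject)

lemma bp_to_bpq_0 [simp]: "bp_to_bpq 0 = 0"
  by (rule poly_mapping_eqI) (simp add: lookup_bp_to_bpq)

lemma bp_to_bpq_1 [simp]: "bp_to_bpq 1 = 1"
  by (rule poly_mapping_eqI) (simp add: lookup_bp_to_bpq Poly_Mapping.lookup_one when_def)

lemma bp_log_0 [simp]: "fps_nth bp_log 0 = 0"
  by (simp add: bp_log_def)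

lemma bp_log_1 [simp]: "fps_nth bp_log (Suc 0) = 1"
proof -
  have "(THE n. Suc 0 = 2 ^ n) = (0::nat)"
    by (rule the_equality) (auto simp: nat_power_eq_Suc_0_iff eq_commute [of "Suc 0"])
  moreover have "\<exists>n. Suc 0 = 2 ^ n" by (rule exI [of _ 0]) simp
  ultimately show ?thesis by (simp add: bp_log_def araki_l.simps [of 0])
qed

lemma bp_log_power_nth: "fps_nth (bp_log ^ n) n = 1"
  by (simp add: startsby_zero_power_nth_same)

lemma bp_exp_oo_bp_log: "bp_exp oo bp_log = fps_X"
proof (rule fps_ext)
  fix n
  have "fps_nth (bp_exp oo bp_log) n = (\<Sum>i=0..n. bp_exp_coeff i * fps_nth (bp_log ^ i) n)"
    by (simp add: fps_compose_nth bp_exp_def)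
  also have "{0..n} = insert n {..<n}" by auto
  also have "(\<Sum>i\<in>insert n {..<n}. bp_exp_coeff i * fps_nth (bp_log ^ i) n) = fps_nth fps_X n"
    by (simp add: bp_log_power_nth bp_exp_coeff.simps [of n])
  finally show "fps_nth (bp_exp oo bp_log) n = fps_nth fps_X n" .
qed

lemma p_0 [simp]: "p 0 = 0"
proof -
  have "inv bp_to_bpq 0 = 0" using inv_f_f [OF inj_bp_to_bpq, of 0] by simp
  then show ?thesis
    by (simp add: p_def two_series_def bp_fgl_def bp_fgl_rat_def bp_exp_def bp_exp_coeff.simps [of 0])
qed

lemma two_series_0 [simp]: "fps_nth two_series 0 = 0"
  using p_0 by (simp add: p_def)


section \<open>The Borel corner \<open>BP\<^sub>*[[e]]/([2](e))\<close>\<close>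

quotient_type borel = "bp fps" / "\<lambda>f g. two_series dvd f - g"
proof (rule equivpI)
  show "reflp (\<lambda>f g. two_series dvd f - g)" by (simp add: reflp_def)
  show "symp (\<lambda>f g. two_series dvd f - g)" by (metis dvd_minus_iff minus_diff_eq sympI)
  show "transp (\<lambda>f g. two_series dvd f - g)"
  proof (rule transpI)
    fix f g h assume "two_series dvd f - g" "two_series dvd g - h"
    then have "two_series dvd (f - g) + (g - h)" by (rule dvd_add)
    then show "two_series dvd f - h" by simp
  qed
qed

instantiation borel :: comm_ring_1
begin

lift_definition zero_borel :: borel is 0 .
lift_definition one_borel :: borel is 1 .

lift_definition plus_borel :: "borel \<Rightarrow> borel \<Rightarrow> borel" is "(+)"
proof -
  fix f f' g g' assume "two_series dvd f - f'" "two_series dvd g - g'"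
  then have "two_series dvd (f - f') + (g - g')" by (rule dvd_add)
  then show "two_series dvd (f + g) - (f' + g')" by (simp add: algebra_simps)
qed

lift_definition uminus_borel :: "borel \<Rightarrow> borel" is uminus
  by (metis dvd_minus_iff minus_diff_minus)

lift_definition minus_borel :: "borel \<Rightarrow> borel \<Rightarrow> borel" is "(-)"
proof -
  fix f f' g g' assume "two_series dvd f - f'" "two_series dvd g - g'"
  then have "two_series dvd (f - f') - (g - g')" by (rule dvd_diff)
  then show "two_series dvd (f - g) - (f' - g')" by (simp add: algebra_simps)
qed

lift_definition times_borel :: "borel \<Rightarrow> borel \<Rightarrow> borel" is "(*)"
proof -
  fix f f' g g' assume "two_series dvd f - f'" "two_series dvd g - g'"
  then have "two_series dvd (f - f') * g + f' * (g - g')" by (intro dvd_add dvd_mult dvd_mult2)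
  then show "two_series dvd f * g - f' * g'" by (simp add: algebra_simps)
qed

instance
proof
  show "(0 :: borel) \<noteq> 1"
  proof transfer
    show "\<not> two_series dvd 0 - 1"
    proof
      assume "two_series dvd 0 - 1"
      then obtain g where "0 - 1 = two_series * g" by (rule dvdE)
      then have "fps_nth (0 - 1 :: bp fps) 0 = fps_nth (two_series * g) 0" by simp
      then show False by simp
    qed
  qed
qed (transfer; simp add: algebra_simps)+

end

lift_definition borel_of_series :: "bp fps \<Rightarrow> borel" is "\<lambda>f. f" .

definition e_borel :: borel
  where "e_borel = borel_of_series fps_X"

text \<open>Restriction to the trivial group on the Borel completion is the augmentation \<open>e \<mapsto> 0\<close>.\<close>

lift_definition borel_res :: "borel \<Rightarrow> bp" is "\<lambda>f. fps_nth f 0"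
proof -
  fix f g assume "two_series dvd f - g"
  then obtain h where "f - g = two_series * h" by (rule dvdE)
  then have "fps_nth (f - g) 0 = fps_nth (two_series * h) 0" by simp
  then show "fps_nth f 0 = fps_nth g 0" by simp
qed


section \<open>The Tate corner \<open>(BP\<^sub>*[[e]]/([2](e)))[e\<^sup>-\<^sup>1]\<close>\<close>

text \<open>A pair \<open>(x, m)\<close> represents the fraction \<open>x / e^m\<close>.\<close>

definition tate_rel :: "borel \<times> nat \<Rightarrow> borel \<times> nat \<Rightarrow> bool"
  where "tate_rel s t \<longleftrightarrow>
    (\<exists>k. e_borel ^ k * (fst s * e_borel ^ snd t) = e_borel ^ k * (fst t * e_borel ^ snd s))"

lemma tate_relI:
  "e_borel ^ k * (x * e_borel ^ n) = e_borel ^ k * (y * e_borel ^ m) \<Longrightarrow> tate_rel (x, m) (y, n)"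
  by (auto simp: tate_rel_def)

quotient_type tate = "borel \<times> nat" / tate_rel
proof (rule equivpI)
  show "reflp tate_rel" by (auto simp: reflp_def tate_rel_def)
  show "symp tate_rel" unfolding symp_def tate_rel_def by metis
  show "transp tate_rel"
  proof (rule transpI)
    fix s t u assume "tate_rel s t" "tate_rel t u"
    then obtain k l where
      k: "e_borel ^ k * (fst s * e_borel ^ snd t) = e_borel ^ k * (fst t * e_borel ^ snd s)" and
      l: "e_borel ^ l * (fst t * e_borel ^ snd u) = e_borel ^ l * (fst u * e_borel ^ snd t)"
      by (auto simp: tate_rel_def)
    have "e_borel ^ (k + l + snd t) * (fst s * e_borel ^ snd u)
        = e_borel ^ l * e_borel ^ snd u * (e_borel ^ k * (fst s * e_borel ^ snd t))"
      by (simp add: power_add algebra_simps)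
    also have "\<dots> = e_borel ^ k * e_borel ^ snd s * (e_borel ^ l * (fst t * e_borel ^ snd u))"
      unfolding k by (simp add: algebra_simps)
    also have "\<dots> = e_borel ^ (k + l + snd t) * (fst u * e_borel ^ snd s)"
      unfolding l by (simp add: power_add algebra_simps)
    finally show "tate_rel s u" unfolding tate_rel_def by blast
  qed
qed

instantiation tate :: "{comm_ring, comm_monoid_mult}"
begin

lift_definition zero_tate :: tate is "(0, 0)" .
lift_definition one_tate :: tate is "(1, 0)" .

lift_definition plus_tate :: "tate \<Rightarrow> tate \<Rightarrow> tate"
  is "\<lambda>(x, m) (y, n). (x * e_borel ^ n + y * e_borel ^ m, m + n)"
  subgoal for s s' t t'
  proof -
    assume "tate_rel s s'" "tate_rel t t'"
    then obtain k l where
      k: "e_borel ^ k * (fst s * e_borel ^ snd s') = e_borel ^ k * (fst s' * e_borel ^ snd s)" and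
      l: "e_borel ^ l * (fst t * e_borel ^ snd t') = e_borel ^ l * (fst t' * e_borel ^ snd t)"
      by (auto simp: tate_rel_def)
    obtain x m x' m' y n y' n' where [simp]: "s = (x, m)" "s' = (x', m')" "t = (y, n)" "t' = (y', n')"
      by (metis surj_pair)
    have "e_borel ^ (k + l) * ((x * e_borel ^ n + y * e_borel ^ m) * e_borel ^ (m' + n'))
        = e_borel ^ l * e_borel ^ n * e_borel ^ n' * (e_borel ^ k * (x * e_borel ^ m'))
        + e_borel ^ k * e_borel ^ m * e_borel ^ m' * (e_borel ^ l * (y * e_borel ^ n'))"
      by (simp add: power_add algebra_simps)
    also have "\<dots> = e_borel ^ l * e_borel ^ n * e_borel ^ n' * (e_borel ^ k * (x' * e_borel ^ m))
        + e_borel ^ k * e_borel ^ m * e_borel ^ m' * (e_borel ^ l * (y' * e_borel ^ n))"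
      using k l by simp
    also have "\<dots> = e_borel ^ (k + l) * ((x' * e_borel ^ n' + y' * e_borel ^ m') * e_borel ^ (m + n))"
      by (simp add: power_add algebra_simps)
    finally show ?thesis by (auto intro: tate_relI)
  qed
  done

lift_definition uminus_tate :: "tate \<Rightarrow> tate" is "\<lambda>(x, m). (- x, m)"
  by (auto simp: tate_rel_def)

definition minus_tate :: "tate \<Rightarrow> tate \<Rightarrow> tate"
  where "minus_tate s t = s + - t"

lift_definition times_tate :: "tate \<Rightarrow> tate \<Rightarrow> tate" is "\<lambda>(x, m) (y, n). (x * y, m + n)"
  subgoal for s s' t t'
  proof -
    assume "tate_rel s s'" "tate_rel t t'"
    then obtain k l where
      k: "e_borel ^ k * (fst s * e_borel ^ snd s') = e_borel ^ k * (fst s' * e_borel ^ snd s)" and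
      l: "e_borel ^ l * (fst t * e_borel ^ snd t') = e_borel ^ l * (fst t' * e_borel ^ snd t)"
      by (auto simp: tate_rel_def)
    obtain x m x' m' y n y' n' where [simp]: "s = (x, m)" "s' = (x', m')" "t = (y, n)" "t' = (y', n')"
      by (metis surj_pair)
    have "e_borel ^ (k + l) * (x * y * e_borel ^ (m' + n'))
        = (e_borel ^ k * (x * e_borel ^ m')) * (e_borel ^ l * (y * e_borel ^ n'))"
      by (simp add: power_add algebra_simps)
    also have "\<dots> = (e_borel ^ k * (x' * e_borel ^ m)) * (e_borel ^ l * (y' * e_borel ^ n))"
      using k l by simp
    also have "\<dots> = e_borel ^ (k + l) * (x' * y' * e_borel ^ (m + n))"
      by (simp add: power_add algebra_simps)
    finally show ?thesis by (auto intro: tate_relI)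
  qed
  done

instance
proof
  fix a b c :: tate
  show "a + b + c = a + (b + c)"
    by transfer (auto simp: power_add algebra_simps intro!: tate_relI [where k = 0])
  show "a + b = b + a"
    by transfer (auto simp: algebra_simps intro!: tate_relI [where k = 0])
  show "0 + a = a"
    by transfer (auto intro!: tate_relI [where k = 0])
  show "- a + a = 0"
    by transfer (auto intro!: tate_relI [where k = 0])
  show "a - b = a + - b" by (rule minus_tate_def)
  show "a * b * c = a * (b * c)"
    by transfer (auto simp: algebra_simps intro!: tate_relI [where k = 0])
  show "a * b = b * a"
    by transfer (auto simp: algebra_simps intro!: tate_relI [where k = 0])
  show "(a + b) * c = a * c + b * c"
    by transfer (auto simp: power_add algebra_simps intro!: tate_relI [where k = 0])
  show "1 * a = a"
    by transfer (auto intro!: tate_relI [where k = 0])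
qed

end

definition tate_of_borel :: "borel \<Rightarrow> tate"
  where "tate_of_borel x = abs_tate (x, 0)"

definition tate_e_power :: "int \<Rightarrow> tate"
  where "tate_e_power k = (if k \<ge> 0 then abs_tate (e_borel ^ nat k, 0) else abs_tate (1, nat (- k)))"


section \<open>The geometric fixed points \<open>BP\<^sub>*[e\<^sup>\<plusminus>\<^sup>1, b\<^sub>i]\<close>\<close>

text \<open>
  The index \<open>(k, c)\<close> stands for the monomial \<open>e^k \<Prod>i. b\<^sub>i^c\<^sub>i\<close> with \<open>k\<close> an integer, where, as
  for \<open>bp\<close>, the exponent \<open>c\<^sub>i\<close> of \<open>b\<^sub>i\<close> (\<open>i \<ge> 1\<close>) is the value of \<open>c\<close> at \<open>i - 1\<close>.
\<close>

type_synonym phi = "(int \<times> (nat \<Rightarrow>\<^sub>0 nat)) \<Rightarrow>\<^sub>0 bp"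

definition phi_of_bp :: "bp \<Rightarrow> phi"
  where "phi_of_bp a = Poly_Mapping.single 0 a"

definition phi_e_power :: "int \<Rightarrow> phi"
  where "phi_e_power k = Poly_Mapping.single (k, 0) 1"

text \<open>
  The lower horizontal map: \<open>e \<mapsto> e\<close>, and \<open>b\<^sub>i\<close> goes to the coefficient of \<open>z^i\<close> in
  \<open>e +\<^sub>B\<^sub>P z\<close>.
\<close>

definition tate_of_phi :: "phi \<Rightarrow> tate"
  where "tate_of_phi x = (\<Sum>(k, c)\<in>Poly_Mapping.keys x.
    tate_of_borel (borel_of_series (fps_const (Poly_Mapping.lookup x (k, c)))) * tate_e_power k *
    (\<Prod>j\<in>Poly_Mapping.keys c.
      tate_of_borel (borel_of_series (fps_nth bp_fgl (j + 1))) ^ Poly_Mapping.lookup c j))"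


section \<open>The homotopy of \<open>BP\<^sub>C\<^sub>2\<close>\<close>

text \<open>Degrees: \<open>|v\<^sub>i| = 2 (2^i - 1)\<close>, \<open>|e| = -2\<close> and \<open>|b\<^sub>i| = 2 i - 2\<close>.\<close>

definition bp_homogeneous :: "int \<Rightarrow> bp \<Rightarrow> bool"
  where "bp_homogeneous d a \<longleftrightarrow> (\<forall>m\<in>Poly_Mapping.keys a.
    d = (\<Sum>j\<in>Poly_Mapping.keys m. int (Poly_Mapping.lookup m j) * (2 * (2 ^ (j + 1) - 1))))"

definition phi_part :: "int \<Rightarrow> phi set"
  where "phi_part d = {x. \<forall>(k, c)\<in>Poly_Mapping.keys x.
    bp_homogeneous
      (d + 2 * k - (\<Sum>j\<in>Poly_Mapping.keys c. int (Poly_Mapping.lookup c j) * (2 * int (j + 1) - 2)))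
      (Poly_Mapping.lookup x (k, c))}"

definition borel_part :: "int \<Rightarrow> borel set"
  where "borel_part d = {borel_of_series f | f. \<forall>k. bp_homogeneous (d + 2 * int k) (fps_nth f k)}"

text \<open>
  \<open>pi_C2 d\<close> is the homotopy in degree \<open>d\<close>: the degree \<open>d\<close> part of the pullback of graded rings.
\<close>

type_synonym bp_c2 = "phi \<times> borel"

definition pi_C2 :: "int \<Rightarrow> bp_c2 set"
  where "pi_C2 d = {(x, y). x \<in> phi_part d \<and> y \<in> borel_part d \<and> tate_of_phi x = tate_of_borel y}"

definition geometric_fixed_points :: "bp_c2 \<Rightarrow> phi"
  where "geometric_fixed_points x = fst x"

definition borel_completion :: "bp_c2 \<Rightarrow> borel"
  where "borel_completion x = snd x"

definition underlying :: "bp_c2 \<Rightarrow> bp"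
  where "underlying x = borel_res (borel_completion x)"

text \<open>The elements \<open>q\<^sub>i\<close> are indexed by \<open>i \<ge> 1\<close>; the value at \<open>0\<close> is irrelevant.\<close>

fun q_geometric :: "nat \<Rightarrow> phi"
  where
    "q_geometric 0 = 0"
  | "q_geometric (Suc 0) = 0"
  | "q_geometric (Suc (Suc i)) = phi_e_power (- 1) * (q_geometric (Suc i) - phi_of_bp (p (Suc i)))"

definition q_borel :: "nat \<Rightarrow> borel"
  where "q_borel i = borel_of_series (Abs_fps (\<lambda>k. p (i + k)))"

definition q :: "nat \<Rightarrow> bp_c2"
  where "q i = (q_geometric i, q_borel i)"


section \<open>Generators\<close>

text \<open>
  For a \<open>BP\<^sub>*\<close>-algebra \<open>R\<close> with structure map \<open>\<eta>\<close>; the span over \<open>R\<close> itself is the ideal generated.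
\<close>

definition v_ideal :: "(bp \<Rightarrow> 'r :: comm_ring_1) \<Rightarrow> nat \<Rightarrow> 'r set"
  where "v_ideal \<eta> m = module.span (*) ((\<lambda>j. \<eta> (v j)) ` {..<m})"

definition v_generator :: "(bp \<Rightarrow> 'r :: comm_ring_1) \<Rightarrow> int \<Rightarrow> 'r \<Rightarrow> bool"
  where "v_generator \<eta> m x \<longleftrightarrow>
    (if m = - 1 then x = 0
     else m \<ge> 0 \<and> (\<exists>\<epsilon>. \<epsilon> dvd 1 \<and> x - \<epsilon> * \<eta> (v (nat m)) \<in> v_ideal \<eta> (nat m)))"

definition v_pair_generator :: "int \<Rightarrow> int \<Rightarrow> bp_c2 \<Rightarrow> bool"
  where "v_pair_generator m k x \<longleftrightarrow>
    v_generator (\<lambda>a. a) m (underlying x) \<and>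
    v_generator phi_of_bp k (geometric_fixed_points x)"

end

(*
  The logarithm l(x) of Araki's formal group law satisfies 2 l(x) = l(2 x) + l(v_1 x^2) + l(v_2 x^4) + ...,
  in which each summand ends with a generator. Comparing coefficients converts this into an expansion
  2 l(x) = 2 x + u_1 (sigma l)(x^2) + u_2 (sigma^2 l)(x^4) + ... with integral u_i, where sigma is the lift
  v_i |-> v_i^2 of Frobenius; Hazewinkel's functional equation lemma then shows that the formal group
  law has coefficients in BP_*, so that [2](x) = exp(2 log x) holds over BP_*.

  The coefficient p_i is homogeneous of degree 2 (i - 1). For degree reasons p_i lies in
  I_m = (v_0, ..., v_(m-1)) for i < 2^m, and for i between 2^m and 2^(m+1) the only coefficients that
  matter modulo I_m are those of v_m in p_(2^m), which is 1, and of v_m^2 in p_(2^(m+1)-1), which is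
  even; both are computed after setting all other generators to 0.
  Since the geometric fixed points of q_i are - (p_1 e^(1-i) + ... + p_(i-1) e^(-1)), only the summand
  p_(2^(n-1)) survives modulo I_(n-1) when i = 2^n. The underlying class of q_i is p_i.
*)
theory Submission
  imports Defs
begin

section \<open>Ring homomorphisms and monoid algebras\<close>

text \<open>The coefficients of \<open>bp_fgl\<close> are chosen preimages under
  \<open>bp_to_bpq\<close>, so nothing can be said about \<open>p\<close> until
  \<open>bp_fgl_rat\<close> is known to be integral; this is why the functional equation lemma
  precedes every computation. Araki's relation does not have the form which that lemma needs, and
  the obstacle is v_0: sigma^i sends v_j to v_j^(2^i) for j > 0, but fixes 2 instead of raising it
  to the power 2^i. The u_i are therefore defined over Q by solving the functional equation, and
  their integrality rests on 2-adic estimates: 2^n l_n is integral, and the discrepancies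
  2^(2^(n-i)) - 2^(2^n) are divisible enough to cancel the denominators. The lemma is proved for
  series in one variable over an arbitrary monoid algebra. The two-variable law enters through a
  homogeneous substitution with one extra monomial generator s. Since sigma s = s^2, the sum log(s
  t) + log(t) has the coefficients l_n sigma^n(1 + s), which is exactly the shape the lemma
  accepts.\<close>

locale ring_morphism =
  fixes h :: "'a :: comm_ring_1 \<Rightarrow> 'b :: comm_ring_1"
  assumes hom_1 [simp]: "h 1 = 1"
    and hom_add: "h (x + y) = h x + h y"
    and hom_mult: "h (x * y) = h x * h y"
begin

lemma hom_0 [simp]: "h 0 = 0"
  using hom_add [of 0 0] by simp

lemma hom_uminus: "h (- x) = - h x"
  using hom_add [of x "- x"] by (simp add: eq_neg_iff_add_eq_0 add.commute)

lemma hom_diff: "h (x - y) = h x - h y"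
  using hom_add [of x "- y"] by (simp add: hom_uminus)

lemma hom_sum: "h (sum f S) = (\<Sum>i\<in>S. h (f i))"
  by (induction S rule: infinite_finite_induct) (simp_all add: hom_add)

lemma hom_power: "h (x ^ n) = h x ^ n"
  by (induction n) (simp_all add: hom_mult)

lemma hom_of_nat [simp]: "h (of_nat n) = of_nat n"
  by (induction n) (simp_all add: hom_add)

lemma hom_numeral [simp]: "h (numeral k) = numeral k"
  by (metis hom_of_nat of_nat_numeral)

end

lemma ring_morphism_funpow:
  fixes h :: "'a :: comm_ring_1 \<Rightarrow> 'a"
  assumes "ring_morphism h"
  shows "ring_morphism (h ^^ n)"
proof (induction n)
  case 0
  show ?case by unfold_locales simp_all
next
  case (Suc n)
  interpret h: ring_morphism h by fact
  interpret hn: ring_morphism "h ^^ n" by fact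
  show ?case by unfold_locales (simp_all add: h.hom_add hn.hom_add h.hom_mult hn.hom_mult)
qed

section \<open>Maps on monoid algebras determined by their values on single terms\<close>

lemma poly_mapping_sum_single:
  fixes x :: "'m \<Rightarrow>\<^sub>0 'a :: comm_monoid_add"
  shows "x = (\<Sum>m\<in>Poly_Mapping.keys x. Poly_Mapping.single m (Poly_Mapping.lookup x m))"
  by (rule poly_mapping_eqI) (auto simp: lookup_sum lookup_single when_def in_keys_iff)

lemma monomial_induct [case_names single add]:
  fixes x :: "'m \<Rightarrow>\<^sub>0 'a :: comm_monoid_add"
  assumes single: "\<And>m c. P (Poly_Mapping.single m c)"
    and add: "\<And>x y. P x \<Longrightarrow> P y \<Longrightarrow> P (x + y)"
  shows "P x"
proof -
  have "P (\<Sum>m\<in>S. Poly_Mapping.single m (Poly_Mapping.lookup x m))" if "finite S" for S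
    using that
  proof induction
    case empty
    show ?case using single [of undefined 0] by simp
  qed (simp add: single add)
  from this [OF finite_keys] show ?thesis
    by (subst poly_mapping_sum_single)
qed

text \<open>The coefficient is an argument of \<open>g\<close> so that base change of coefficients,
  the Frobenius lift, the adjunction of s and the specialization of generators are all instances; so
  is the lower map of the pullback square, which is treated as an additive map.\<close>

definition monomial_extend :: "('m \<Rightarrow> 'a \<Rightarrow> 'b) \<Rightarrow> ('m \<Rightarrow>\<^sub>0 'a :: zero) \<Rightarrow> 'b :: comm_monoid_add"
  where "monomial_extend g x = (\<Sum>m\<in>Poly_Mapping.keys x. g m (Poly_Mapping.lookup x m))"

locale monomial_additive =
  fixes g :: "'m \<Rightarrow> 'a :: ab_group_add \<Rightarrow> 'b :: ab_group_add"
  assumes g_add: "g m (a + b) = g m a + g m b"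
begin

lemma g_0 [simp]: "g m 0 = 0"
  using g_add [of m 0 0] by simp

lemma extend_superset:
  assumes "finite S" "Poly_Mapping.keys x \<subseteq> S"
  shows "monomial_extend g x = (\<Sum>m\<in>S. g m (Poly_Mapping.lookup x m))"
  unfolding monomial_extend_def using assms
  by (intro sum.mono_neutral_left) (auto simp: in_keys_iff)

lemma extend_add: "monomial_extend g (x + y) = monomial_extend g x + monomial_extend g y"
proof -
  let ?S = "Poly_Mapping.keys x \<union> Poly_Mapping.keys y"
  have "Poly_Mapping.keys (x + y) \<subseteq> ?S" by (rule Poly_Mapping.keys_add)
  then show ?thesis
    by (simp add: extend_superset [of ?S] lookup_add g_add sum.distrib)
qed

lemma extend_single [simp]: "monomial_extend g (Poly_Mapping.single m c) = g m c"
  by (simp add: extend_superset [of "{m}"])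

lemma extend_0 [simp]: "monomial_extend g 0 = 0"
  by (simp add: monomial_extend_def)

lemma extend_sum: "monomial_extend g (sum f S) = (\<Sum>i\<in>S. monomial_extend g (f i))"
  by (induction S rule: infinite_finite_induct) (simp_all add: extend_add)

end

locale monomial_hom = monomial_additive g
  for g :: "'m :: comm_monoid_add \<Rightarrow> 'a :: comm_ring_1 \<Rightarrow> 'b :: comm_ring_1" +
  assumes g_1: "g 0 1 = 1"
    and g_mult: "g (m + n) (a * b) = g m a * g n b"
begin

sublocale ring_morphism "monomial_extend g"
proof
  show "monomial_extend g 1 = 1"
    by (simp flip: single_one add: g_1)
  show "monomial_extend g (x + y) = monomial_extend g x + monomial_extend g y" for x y
    by (rule extend_add)
  show "monomial_extend g (x * y) = monomial_extend g x * monomial_extend g y" for x y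
  proof (induction x rule: monomial_induct)
    case (single m c)
    show ?case
      by (induction y rule: monomial_induct) (simp_all add: mult_single g_mult extend_add algebra_simps)
  qed (simp add: extend_add algebra_simps)
qed

end


section \<open>Integrality and the Frobenius lift\<close>

abbreviation scalar :: "'a \<Rightarrow> ('m :: zero) \<Rightarrow>\<^sub>0 ('a :: zero)"
  where "scalar \<equiv> Poly_Mapping.single 0"

lemma rat_of_z2_hom: "ring_morphism rat_of_z2"
  by unfold_locales (simp_all add: plus_z2loc.rep_eq times_z2loc.rep_eq)

interpretation rat_of_z2: ring_morphism rat_of_z2
  by (rule rat_of_z2_hom)

lemma range_rat_of_z2: "range rat_of_z2 = {r. odd (snd (quotient_of r))}"
  using type_definition.Rep_range [OF type_definition_z2loc] by simp

lemma z2_fractionI: "odd b \<Longrightarrow> of_int a / of_int b \<in> range rat_of_z2"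
  unfolding range_rat_of_z2 by (rule CollectI, rule odd_denominatorI [OF refl])

lemma z2_fractionE:
  assumes "r \<in> range rat_of_z2"
  obtains a b where "r = of_int a / of_int b" "odd b"
  using assms unfolding range_rat_of_z2 by (auto elim: odd_denominatorE)

text \<open>Fermat's congruence at 2: for c = a/b the numerator a (b - a) of c - c^2 is even because
  b is odd. It makes the identity a lift of Frobenius on scalars.\<close>

lemma z2_frobenius:
  assumes "c \<in> range rat_of_z2"
  shows "(c - c ^ 2) / 2 \<in> range rat_of_z2"
proof -
  obtain a b where ab: "c = of_int a / of_int b" "odd b"
    using assms by (rule z2_fractionE)
  then have "even (a * (b - a))" by auto
  then obtain k where k: "a * (b - a) = 2 * k" by (rule evenE)
  have "b \<noteq> 0" using ab(2) by auto
  then have "(c - c ^ 2) / 2 = of_int (a * (b - a)) / (2 * of_int (b ^ 2))"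
    by (simp add: ab(1) field_simps power2_eq_square)
  also have "\<dots> = of_int k / of_int (b ^ 2)"
    unfolding k by simp
  also have "\<dots> \<in> range rat_of_z2"
    using ab(2) by (intro z2_fractionI) simp
  finally show ?thesis .
qed

text \<open>The monomials are left arbitrary because the notion is applied both to BP over Q and to
  the same ring with the variable s adjoined.\<close>

definition integral :: "('m \<Rightarrow>\<^sub>0 rat) set"
  where "integral = {x. \<forall>m. Poly_Mapping.lookup x m \<in> range rat_of_z2}"

abbreviation of_z2_monomials :: "('m \<Rightarrow>\<^sub>0 z2loc) \<Rightarrow> ('m \<Rightarrow>\<^sub>0 rat)"
  where "of_z2_monomials \<equiv> monomial_extend (\<lambda>m c. Poly_Mapping.single m (rat_of_z2 c))"

interpretation of_z2: monomial_hom "\<lambda>m c. Poly_Mapping.single m (rat_of_z2 c)"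
  by unfold_locales (simp_all add: rat_of_z2.hom_add rat_of_z2.hom_mult single_add mult_single)

lemma lookup_extend_coeff:
  assumes "f 0 = 0"
  shows "Poly_Mapping.lookup (monomial_extend (\<lambda>m c. Poly_Mapping.single m (f c)) x) k
    = f (Poly_Mapping.lookup x k)"
  using assms by (simp add: monomial_extend_def lookup_sum lookup_single when_def in_keys_iff)

lemma bp_to_bpq_eq: "bp_to_bpq = monomial_extend (\<lambda>m c. Poly_Mapping.single m (rat_of_z2 c))"
  by (rule ext, rule poly_mapping_eqI) (simp add: lookup_bp_to_bpq lookup_extend_coeff)

interpretation bp_to_bpq: ring_morphism bp_to_bpq
  unfolding bp_to_bpq_eq by unfold_locales

text \<open>As the image of a ring homomorphism, the integral elements are closed under the ring
  operations without any computation of coefficients of products.\<close>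

lemma integral_eq_range:
  "(integral :: ('m :: comm_monoid_add \<Rightarrow>\<^sub>0 rat) set)
    = range of_z2_monomials"
proof (intro equalityI subsetI)
  fix x :: "'m \<Rightarrow>\<^sub>0 rat"
  assume x: "x \<in> integral"
  let ?y = "Poly_Mapping.map z2_of_rat x"
  have z: "z2_of_rat 0 = 0"
    by (metis rat_of_z2_0 rat_of_z2_inverse)
  have "of_z2_monomials ?y = x"
  proof (rule poly_mapping_eqI)
    fix k
    obtain c where "Poly_Mapping.lookup x k = rat_of_z2 c"
      using x by (auto simp: integral_def)
    then show "Poly_Mapping.lookup (of_z2_monomials ?y) k
        = Poly_Mapping.lookup x k"
      by (simp add: lookup_extend_coeff Poly_Mapping.map.rep_eq when_def rat_of_z2_inverse)
  qed
  then show "x \<in> range of_z2_monomials"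
    by (metis rangeI)
qed (auto simp: integral_def lookup_extend_coeff)

lemma range_bp_to_bpq: "range bp_to_bpq = integral"
  by (simp add: bp_to_bpq_eq integral_eq_range)

context
  fixes x y :: "'m :: comm_monoid_add \<Rightarrow>\<^sub>0 rat"
  assumes x: "x \<in> integral" and y: "y \<in> integral"
begin

lemma integral_add: "x + y \<in> integral"
proof -
  obtain a b where "x = of_z2_monomials a" "y = of_z2_monomials b"
    using x y unfolding integral_eq_range by blast
  then have "x + y = of_z2_monomials (a + b)"
    by (simp only: of_z2.hom_add)
  then show ?thesis
    unfolding integral_eq_range by (rule range_eqI)
qed

lemma integral_diff: "x - y \<in> integral"
proof -
  obtain a b where "x = of_z2_monomials a" "y = of_z2_monomials b"
    using x y unfolding integral_eq_range by blast
  then have "x - y = of_z2_monomials (a - b)"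
    by (simp only: of_z2.hom_diff)
  then show ?thesis
    unfolding integral_eq_range by (rule range_eqI)
qed

lemma integral_mult: "x * y \<in> integral"
proof -
  obtain a b where "x = of_z2_monomials a" "y = of_z2_monomials b"
    using x y unfolding integral_eq_range by blast
  then have "x * y = of_z2_monomials (a * b)"
    by (simp only: of_z2.hom_mult)
  then show ?thesis
    unfolding integral_eq_range by (rule range_eqI)
qed

end

lemma integral_single: "c \<in> range rat_of_z2 \<Longrightarrow> Poly_Mapping.single m c \<in> integral"
  by (auto simp: integral_def lookup_single when_def intro: range_eqI [of _ _ 0])

lemma integral_0 [simp]: "0 \<in> integral"
  by (auto simp: integral_def intro: range_eqI [of _ _ 0])

lemma integral_1 [simp]: "1 \<in> (integral :: ('m :: comm_monoid_add \<Rightarrow>\<^sub>0 rat) set)"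
  by (simp flip: single_one add: integral_single range_eqI [of _ _ 1])

lemma integral_sum:
  "(\<And>i. i \<in> S \<Longrightarrow> f i \<in> integral) \<Longrightarrow>
    sum f S \<in> (integral :: ('m :: comm_monoid_add \<Rightarrow>\<^sub>0 rat) set)"
  by (induction S rule: infinite_finite_induct) (simp_all add: integral_add)

lemma integral_power: "x \<in> integral \<Longrightarrow> x ^ n \<in> (integral :: ('m :: comm_monoid_add \<Rightarrow>\<^sub>0 rat) set)"
  by (induction n) (simp_all add: integral_mult)

lemma integral_of_nat [simp]: "of_nat n \<in> (integral :: ('m :: comm_monoid_add \<Rightarrow>\<^sub>0 rat) set)"
  by (induction n) (simp_all add: integral_add)

lemma integral_numeral [simp]: "numeral k \<in> (integral :: ('m :: comm_monoid_add \<Rightarrow>\<^sub>0 rat) set)"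
  by (metis integral_of_nat of_nat_numeral)

section \<open>The lift sigma of Frobenius and its congruence with squaring\<close>

definition frobenius :: "('m :: comm_monoid_add \<Rightarrow>\<^sub>0 rat) \<Rightarrow> ('m \<Rightarrow>\<^sub>0 rat)"
  where "frobenius = monomial_extend (\<lambda>m c. Poly_Mapping.single (m + m) c)"

lemma frobenius_hom: "ring_morphism (frobenius :: ('m :: comm_monoid_add \<Rightarrow>\<^sub>0 rat) \<Rightarrow> _)"
proof -
  interpret monomial_hom "\<lambda>(m :: 'm :: comm_monoid_add) c :: rat. Poly_Mapping.single (m + m) c"
    by unfold_locales (simp_all add: single_add mult_single add_ac)
  show "ring_morphism (frobenius :: ('m \<Rightarrow>\<^sub>0 rat) \<Rightarrow> _)"
    unfolding frobenius_def by unfold_locales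
qed

interpretation frobenius: ring_morphism frobenius
  by (rule frobenius_hom)

lemma frobenius_single [simp]: "frobenius (Poly_Mapping.single m c) = Poly_Mapping.single (m + m) c"
  by (cases "c = 0") (simp_all add: frobenius_def monomial_extend_def)

text \<open>The square of a sum of terms differs from the sum of their squares by doubled cross
  terms, and on a single term only c - c^2 remains, which \<open>z2_frobenius\<close> halves. The
  induction also carries integrality of the partial sums, since they enter the cross terms.\<close>

lemma frobenius_cong:
  fixes x :: "'m :: comm_monoid_add \<Rightarrow>\<^sub>0 rat"
  assumes "x \<in> integral"
  obtains w where "w \<in> integral" "frobenius x = x ^ 2 + 2 * w"
proof -
  let ?m = "\<lambda>m. Poly_Mapping.single m (Poly_Mapping.lookup x m)"
  have "\<exists>w\<in>integral. frobenius (\<Sum>m\<in>S. ?m m) = (\<Sum>m\<in>S. ?m m) ^ 2 + 2 * w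
      \<and> (\<Sum>m\<in>S. ?m m) \<in> integral" if "finite S" for S
    using that
  proof induction
    case empty
    show ?case by (auto intro!: bexI [of _ 0])
  next
    case (insert m S)
    then obtain w where w: "w \<in> integral" "(\<Sum>m\<in>S. ?m m) \<in> integral"
      "frobenius (\<Sum>m\<in>S. ?m m) = (\<Sum>m\<in>S. ?m m) ^ 2 + 2 * w" by blast
    let ?c = "Poly_Mapping.lookup x m"
    have c: "?c \<in> range rat_of_z2" using assms by (simp add: integral_def)
    let ?t = "Poly_Mapping.single (m + m) ((?c - ?c ^ 2) / 2)"
    have t: "?t \<in> integral" by (intro integral_single z2_frobenius c)
    have m: "?m m \<in> integral" by (intro integral_single c)
    have "?m m ^ 2 + 2 * ?t = Poly_Mapping.single (m + m) ?c"
      unfolding power2_eq_square mult_single mult_2 single_add [symmetric] by simp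
    then have "frobenius (\<Sum>m\<in>insert m S. ?m m)
        = (\<Sum>m\<in>insert m S. ?m m) ^ 2 + 2 * (w + ?t - ?m m * (\<Sum>m\<in>S. ?m m))"
      using insert.hyps by (simp add: frobenius.hom_add w power2_eq_square algebra_simps)
    moreover have "w + ?t - ?m m * (\<Sum>m\<in>S. ?m m) \<in> integral"
      by (intro integral_add integral_diff integral_mult w t m)
    moreover have "(\<Sum>m\<in>insert m S. ?m m) \<in> integral"
      using insert.hyps w m by (simp add: integral_add)
    ultimately show ?case by blast
  qed
  from this [OF finite_keys [of x]] show ?thesis
    using that by (auto simp flip: poly_mapping_sum_single)
qed

lemma frobenius_integral:
  fixes x :: "'m :: comm_monoid_add \<Rightarrow>\<^sub>0 rat"
  assumes "x \<in> integral"
  shows "frobenius x \<in> integral"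
proof -
  obtain w where "w \<in> integral" "frobenius x = x ^ 2 + 2 * w"
    using frobenius_cong [OF assms] .
  then show ?thesis
    using assms by (simp add: integral_add integral_mult integral_power)
qed

lemma frobenius_funpow_integral:
  fixes x :: "'m :: comm_monoid_add \<Rightarrow>\<^sub>0 rat"
  shows "x \<in> integral \<Longrightarrow> (frobenius ^^ n) x \<in> integral"
  by (induction n) (simp_all add: frobenius_integral)

interpretation frobenius_funpow: ring_morphism "frobenius ^^ n" for n
  by (intro ring_morphism_funpow frobenius.ring_morphism_axioms)


text \<open>For substituting an expansion of l_j with first factors u_i into a sum over j and
  regrouping by i; then m = j - i is the index in sigma^i l_m.\<close>

lemma sum_triangle_shift:
  fixes f :: "nat \<Rightarrow> nat \<Rightarrow> 'a :: comm_monoid_add"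
  shows "(\<Sum>j\<in>{1..n}. \<Sum>i\<in>{1..j}. f i j) = (\<Sum>i\<in>{1..n}. \<Sum>m\<le>n - i. f i (i + m))"
  unfolding sum.Sigma [OF finite_atLeastAtMost ballI [OF finite_atLeastAtMost]]
    sum.Sigma [OF finite_atLeastAtMost ballI [OF finite_atMost]]
  by (rule sum.reindex_bij_witness [where j = "\<lambda>(j, i). (i, j - i)" and i = "\<lambda>(i, m). (i + m, i)"]) auto

lemma scalar_hom: "ring_morphism (scalar :: 'a :: comm_ring_1 \<Rightarrow> 'm :: comm_monoid_add \<Rightarrow>\<^sub>0 'a)"
  by unfold_locales (simp_all add: single_add mult_single)

interpretation scalar: ring_morphism "scalar :: 'a :: comm_ring_1 \<Rightarrow> 'm :: comm_monoid_add \<Rightarrow>\<^sub>0 'a"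
  by (rule scalar_hom)


section \<open>A functional equation for Araki's logarithm\<close>

lemma bp_to_bpq_v0 [simp]: "bp_to_bpq (v 0) = 2"
  by (simp add: v_def)

lemma bp_to_bpq_single [simp]:
  "bp_to_bpq (Poly_Mapping.single m c) = Poly_Mapping.single m (rat_of_z2 c)"
  by (simp add: bp_to_bpq_eq of_z2.extend_single)

lemma bp_to_bpq_v: "j > 0 \<Longrightarrow> bp_to_bpq (v j) = Poly_Mapping.single (Poly_Mapping.single (j - 1) 1) 1"
  by (simp add: v_def)

text \<open>The case j = 0 is excluded because sigma fixes the scalar v_0 = 2. This is the only
  discrepancy between Araki's relation and a functional equation with u_i = v_i.\<close>

lemma frobenius_funpow_v: "j > 0 \<Longrightarrow> (frobenius ^^ i) (bp_to_bpq (v j)) = bp_to_bpq (v j) ^ 2 ^ i"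
proof (induction i)
  case (Suc i)
  have "frobenius (bp_to_bpq (v j)) = bp_to_bpq (v j) ^ 2"
    using Suc.prems by (simp add: bp_to_bpq_v power2_eq_square mult_single)
  then show ?case
    using Suc by (simp add: frobenius.hom_power flip: power_mult)
qed simp

lemma bp_to_bpq_integral [simp]: "bp_to_bpq a \<in> integral"
  using range_bp_to_bpq by blast

lemma pow_pow_neq_two:
  assumes "n > 0"
  shows "(2 :: rat) - 2 ^ 2 ^ n \<noteq> 0"
proof -
  have "1 < (2 :: nat) ^ n" using assms by (metis one_less_power one_less_numeral_iff semiring_norm(76))
  then have "(2 :: rat) ^ 1 < 2 ^ 2 ^ n"
    by (rule power_strict_increasing) simp
  then show ?thesis by simp
qed

lemma araki_l_0 [simp]: "araki_l 0 = 1"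
  by (simp add: araki_l.simps [of 0])

lemma araki_recurrence:
  "2 * araki_l n = (\<Sum>i\<le>n. araki_l i * bp_to_bpq (v (n - i)) ^ 2 ^ i)"
proof (cases "n = 0")
  case False
  let ?K = "2 - 2 ^ 2 ^ n"
  have "(?K :: bpq) = scalar ?K"
    by (simp only: scalar.hom_diff scalar.hom_power scalar.hom_numeral)
  then have "?K * araki_l n = (\<Sum>i<n. araki_l i * bp_to_bpq (v (n - i)) ^ 2 ^ i)"
    using False pow_pow_neq_two [of n]
    by (simp add: araki_l.simps [of n] mult_single flip: mult.assoc)
  then show ?thesis
    by (simp add: lessThan_Suc_atMost [symmetric] algebra_simps)
qed simp

text \<open>One factor 2 cancels: 2 / (2 - 2^(2^n)) = 1 / (1 - 2^(2^n - 1)), and for n > 0 this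
  denominator is odd.\<close>

lemma araki_denominator:
  assumes "n > 0"
  shows "2 * scalar (1 / (2 - 2 ^ 2 ^ n)) \<in> (integral :: ('m :: comm_monoid_add \<Rightarrow>\<^sub>0 rat) set)"
proof -
  have "1 < (2 :: nat) ^ n" using assms by (metis one_less_power one_less_numeral_iff semiring_norm(76))
  then obtain k where k: "2 ^ n = Suc (Suc k)"
    using less_iff_Suc_add [of 1 "2 ^ n"] by auto
  have "2 * scalar (1 / (2 - 2 ^ 2 ^ n)) = (scalar (2 * (1 / (2 - 2 ^ 2 ^ n))) :: 'm \<Rightarrow>\<^sub>0 rat)"
    by (simp only: scalar.hom_mult scalar.hom_numeral)
  also have "(2 :: rat) * (1 / (2 - 2 ^ 2 ^ n)) = of_int 1 / of_int (1 - 2 ^ Suc k)"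
    using pow_pow_neq_two [OF assms] unfolding k by (simp add: field_simps)
  finally show ?thesis
    by (simp only:) (intro integral_single z2_fractionI, simp)
qed

text \<open>By \<open>araki_denominator\<close> each step of the recursion costs one factor 2, and
  the remaining 2^(n-1) pays for the denominators of all l_i with i < n. The bound matches the gain
  in \<open>power_two_power_cong\<close>.\<close>

lemma araki_l_integral: "2 ^ n * araki_l n \<in> integral"
proof (induction n rule: less_induct)
  case (less n)
  show ?case
  proof (cases "n = 0")
    case False
    let ?a = "\<lambda>i. 2 ^ (n - 1) * (araki_l i * bp_to_bpq (v (n - i)) ^ 2 ^ i)"
    have "?a i \<in> integral" if "i < n" for i
    proof -
      have "n - 1 = (n - 1 - i) + i" using that by simp
      then have "(2 :: bpq) ^ (n - 1) = 2 ^ (n - 1 - i) * 2 ^ i" by (metis power_add)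
      then have "?a i = 2 ^ (n - 1 - i) * (2 ^ i * araki_l i) * bp_to_bpq (v (n - i)) ^ 2 ^ i"
        by (simp only: mult_ac)
      also have "\<dots> \<in> integral"
        by (rule integral_mult [OF integral_mult [OF integral_power [OF integral_numeral] less [OF that]]
          integral_power [OF bp_to_bpq_integral]])
      finally show ?thesis .
    qed
    then have "(\<Sum>i<n. ?a i) \<in> integral"
      by (intro integral_sum) auto
    with False have "2 * scalar (1 / (2 - 2 ^ 2 ^ n)) * (\<Sum>i<n. ?a i) \<in> integral"
      by (intro integral_mult [OF araki_denominator]) auto
    also have "2 * scalar (1 / (2 - 2 ^ 2 ^ n)) * (\<Sum>i<n. ?a i) = (2 * 2 ^ (n - 1)) * araki_l n"
      by (subst sum_distrib_left [symmetric]) (use False in \<open>simp add: araki_l.simps [of n] mult_ac\<close>)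
    also have "2 * 2 ^ (n - 1) = (2 :: bpq) ^ n"
      using False by (simp flip: power_Suc)
    finally show ?thesis .
  qed simp
qed

text \<open>The recursion solves \<open>honda_equation\<close> for its last summand, in which l_0 =
  1. In Honda's terms, 2 - u_1 T - u_2 T^2 - ... is a type of the logarithm.\<close>

fun honda_u :: "nat \<Rightarrow> bpq"
  where "honda_u n = 2 * araki_l n - (\<Sum>i\<in>{1..<n}. honda_u i * (frobenius ^^ i) (araki_l (n - i)))"

declare honda_u.simps [simp del]

lemma honda_equation:
  assumes "n > 0"
  shows "2 * araki_l n = (\<Sum>i\<in>{1..n}. honda_u i * (frobenius ^^ i) (araki_l (n - i)))"
proof -
  have "{1..n} = insert n {1..<n}" using assms by auto
  then show ?thesis by (simp add: honda_u.simps [of n])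
qed

text \<open>Applying sigma^i to Araki's relation raises the v's correctly except in the term m = k,
  where v_0^(2^k) stays 2^(2^k) although 2^(2^(i+k)) is wanted; the last factor records the
  difference.\<close>

lemma frobenius_araki_recurrence:
  assumes "i > 0"
  shows "(\<Sum>m\<le>k. (frobenius ^^ i) (araki_l m) * bp_to_bpq (v (k - m)) ^ 2 ^ (i + m))
    = (frobenius ^^ i) (araki_l k) * (2 + 2 ^ 2 ^ (i + k) - 2 ^ 2 ^ k)"
proof -
  let ?f = "(frobenius :: bpq \<Rightarrow> bpq) ^^ i"
  have *: "?f (bp_to_bpq (v (k - m)) ^ 2 ^ m) = bp_to_bpq (v (k - m)) ^ 2 ^ (i + m)" if "m < k" for m
    using that by (simp only: frobenius_funpow.hom_power frobenius_funpow_v zero_less_diff power_add power_mult)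
  have "2 * ?f (araki_l k) = ?f (2 * araki_l k)"
    by (simp add: frobenius_funpow.hom_mult)
  also have "\<dots> = (\<Sum>m<k. ?f (araki_l m) * bp_to_bpq (v (k - m)) ^ 2 ^ (i + m)) + ?f (araki_l k) * 2 ^ 2 ^ k"
    unfolding araki_recurrence
    by (simp add: lessThan_Suc_atMost [symmetric] frobenius_funpow.hom_add frobenius_funpow.hom_sum
      frobenius_funpow.hom_mult * cong: sum.cong_simp)
      (simp add: frobenius_funpow.hom_power)
  finally show ?thesis
    by (simp add: lessThan_Suc_atMost [symmetric] algebra_simps)
qed

text \<open>Comparing the two expansions of \<open>2 l\<^sub>n\<close>, one ending and one beginning with a generator.\<close>

lemma honda_u_recurrence:
  assumes "n > 0"
  shows "(\<Sum>i\<in>{1..n}. honda_u i * (frobenius ^^ i) (araki_l (n - i)) * (2 ^ 2 ^ (n - i) - 2 ^ 2 ^ n))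
    = 2 * bp_to_bpq (v n)"
proof -
  let ?s = "\<lambda>i k. (frobenius ^^ i) (araki_l k)"
  let ?V = "\<lambda>j. bp_to_bpq (v j)"
  \<comment> \<open>The extra factor 2 is what allows each l_j with j > 0 inside Araki's relation to
    be expanded by \<open>honda_equation\<close> in turn.\<close>
  have "2 * (2 * araki_l n) = 2 * (\<Sum>j\<in>insert 0 {1..n}. araki_l j * ?V (n - j) ^ 2 ^ j)"
    unfolding araki_recurrence [of n] by (rule arg_cong [of _ _ "\<lambda>S. 2 * sum _ S"]) auto
  also have "\<dots> = 2 * ?V n + (\<Sum>j\<in>{1..n}. 2 * araki_l j * ?V (n - j) ^ 2 ^ j)"
    by (simp add: algebra_simps sum_distrib_left)
  also have "(\<Sum>j\<in>{1..n}. 2 * araki_l j * ?V (n - j) ^ 2 ^ j)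
      = (\<Sum>j\<in>{1..n}. \<Sum>i\<in>{1..j}. honda_u i * (?s i (j - i) * ?V (n - j) ^ 2 ^ j))"
    by (intro sum.cong) (simp_all add: honda_equation sum_distrib_right mult.assoc)
  also have "\<dots> = (\<Sum>i\<in>{1..n}. \<Sum>m\<in>{..n - i}. honda_u i * (?s i m * ?V (n - i - m) ^ 2 ^ (i + m)))"
    unfolding sum_triangle_shift by simp
  also have "\<dots> = (\<Sum>i\<in>{1..n}. honda_u i * (?s i (n - i) * (2 + 2 ^ 2 ^ n - 2 ^ 2 ^ (n - i))))"
  proof (rule sum.cong)
    fix i assume "i \<in> {1..n}"
    then show "(\<Sum>m\<le>n - i. honda_u i * (?s i m * ?V (n - i - m) ^ 2 ^ (i + m)))
        = honda_u i * (?s i (n - i) * (2 + 2 ^ 2 ^ n - 2 ^ 2 ^ (n - i)))"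
      using frobenius_araki_recurrence [of i "n - i"] by (simp flip: sum_distrib_left)
  qed simp
  also have "\<dots> = 2 * (2 * araki_l n)
      - (\<Sum>i\<in>{1..n}. honda_u i * ?s i (n - i) * (2 ^ 2 ^ (n - i) - 2 ^ 2 ^ n))"
    unfolding honda_equation [OF assms] sum_distrib_left sum_subtractf [symmetric]
    by (intro sum.cong) (simp_all add: algebra_simps)
  finally show ?thesis by simp
qed

text \<open>Since n - i + 1 <= 2^(n-i), the factor 2^(2^(n-i)) - 2^(2^n) in
  \<open>honda_u_recurrence\<close> is divisible by 2^(n-i+1): a part 2^(n-i) clears the
  denominators of l_(n-i) and a factor 2 is left over. So u_n (2 - 2^(2^n)) is twice an integral
  element, and \<open>araki_denominator\<close> concludes.\<close>

lemma honda_u_integral: "n > 0 \<Longrightarrow> honda_u n \<in> integral"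
proof (induction n rule: less_induct)
  case (less n)
  let ?t = "\<lambda>i. honda_u i * (frobenius ^^ i) (araki_l (n - i)) * (2 ^ 2 ^ (n - i) - 2 ^ 2 ^ n)"
  let ?w = "\<lambda>i. honda_u i * (frobenius ^^ i) (2 ^ (n - i) * araki_l (n - i))
    * (2 ^ (2 ^ (n - i) - Suc (n - i)) * (1 - 2 ^ (2 ^ n - 2 ^ (n - i))))"
  have t: "?t i = 2 * ?w i" for i
  proof -
    have "n - i < 2 ^ (n - i)" by (rule less_exp)
    then have "2 ^ (n - i) = Suc (n - i) + (2 ^ (n - i) - Suc (n - i))" by linarith
    then have a: "(2 :: bpq) ^ 2 ^ (n - i) = 2 * 2 ^ (n - i) * 2 ^ (2 ^ (n - i) - Suc (n - i))"
      by (simp flip: power_add power_Suc)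
    have "(2 :: nat) ^ n = 2 ^ (n - i) + (2 ^ n - 2 ^ (n - i))" by simp
    then have b: "(2 :: bpq) ^ 2 ^ n = 2 ^ 2 ^ (n - i) * 2 ^ (2 ^ n - 2 ^ (n - i))"
      by (simp flip: power_add)
    show ?thesis
      unfolding b unfolding a
      by (simp add: frobenius_funpow.hom_mult frobenius_funpow.hom_power algebra_simps)
  qed
  have w: "?w i \<in> integral" if "i \<in> {1..<n}" for i
    using that less.IH [of i]
    by (intro integral_mult integral_diff integral_power frobenius_funpow_integral araki_l_integral) auto
  have "{1..n} = insert n {1..<n}" using less.prems by auto
  then have sum: "?t n + (\<Sum>i\<in>{1..<n}. ?t i) = 2 * bp_to_bpq (v n)"
    using honda_u_recurrence [OF less.prems] by simp
  have "honda_u n * (2 - 2 ^ 2 ^ n) = ?t n" by simp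
  also have "\<dots> = 2 * bp_to_bpq (v n) - (\<Sum>i\<in>{1..<n}. ?t i)"
    unfolding eq_diff_eq by (rule sum)
  also have "\<dots> = 2 * (bp_to_bpq (v n) - (\<Sum>i\<in>{1..<n}. ?w i))"
    by (simp only: t sum_distrib_left [symmetric] right_diff_distrib [of _ "bp_to_bpq (v n)"])
  finally have eq: "honda_u n * (2 - 2 ^ 2 ^ n) = 2 * (bp_to_bpq (v n) - (\<Sum>i\<in>{1..<n}. ?w i))" .
  have "(2 - 2 ^ 2 ^ n) * scalar (1 / (2 - 2 ^ 2 ^ n)) = scalar (2 - 2 ^ 2 ^ n) * (scalar (1 / (2 - 2 ^ 2 ^ n)) :: bpq)"
    by (simp only: scalar.hom_diff scalar.hom_power scalar.hom_numeral)
  also have "\<dots> = 1"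
    using pow_pow_neq_two [OF less.prems] by (simp add: mult_single)
  finally have "honda_u n = honda_u n * (2 - 2 ^ 2 ^ n) * scalar (1 / (2 - 2 ^ 2 ^ n))"
    unfolding mult.assoc by simp
  also have "\<dots> = 2 * scalar (1 / (2 - 2 ^ 2 ^ n)) * (bp_to_bpq (v n) - (\<Sum>i\<in>{1..<n}. ?w i))"
    unfolding eq by (simp only: mult_ac)
  also have "\<dots> \<in> integral"
    by (intro integral_mult [OF araki_denominator] integral_diff integral_sum w less.prems bp_to_bpq_integral)
  finally show ?case .
qed


section \<open>Hazewinkel's functional equation lemma\<close>

definition integral_fps :: "('m :: comm_monoid_add \<Rightarrow>\<^sub>0 rat) fps set"
  where "integral_fps = {G. \<forall>n. fps_nth G n \<in> integral}"

lemma integral_fps_add: "F \<in> integral_fps \<Longrightarrow> G \<in> integral_fps \<Longrightarrow> F + G \<in> integral_fps"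
  by (simp add: integral_fps_def integral_add)

lemma integral_fps_mult: "F \<in> integral_fps \<Longrightarrow> G \<in> integral_fps \<Longrightarrow> F * G \<in> integral_fps"
  by (simp add: integral_fps_def fps_mult_nth integral_sum integral_mult)

lemma integral_fps_1 [simp]: "1 \<in> integral_fps"
  by (simp add: integral_fps_def)

lemma integral_fps_power: "F \<in> integral_fps \<Longrightarrow> F ^ n \<in> integral_fps"
  by (induction n) (simp_all add: integral_fps_mult)

lemma integral_fps_numeral [simp]: "numeral k \<in> integral_fps"
  by (simp add: integral_fps_def numeral_fps_const)

text \<open>The series variable is squared along with the monomials: F(t) goes to (sigma
  F)(t^2).\<close>

definition frobenius_fps :: "('m :: comm_monoid_add \<Rightarrow>\<^sub>0 rat) fps \<Rightarrow> ('m \<Rightarrow>\<^sub>0 rat) fps"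
  where "frobenius_fps F = Abs_fps (\<lambda>n. if even n then frobenius (fps_nth F (n div 2)) else 0)"

lemma frobenius_fps_nth:
  "fps_nth (frobenius_fps F) n = (if even n then frobenius (fps_nth F (n div 2)) else 0)"
  by (simp add: frobenius_fps_def)

lemma frobenius_fps_hom:
  "ring_morphism (frobenius_fps :: ('m :: comm_monoid_add \<Rightarrow>\<^sub>0 rat) fps \<Rightarrow> _)"
proof
  show "frobenius_fps 1 = (1 :: ('m :: comm_monoid_add \<Rightarrow>\<^sub>0 rat) fps)"
    by (rule fps_ext) (auto simp: frobenius_fps_nth elim: evenE)
next
  fix F G :: "('m \<Rightarrow>\<^sub>0 rat) fps"
  show "frobenius_fps (F + G) = frobenius_fps F + frobenius_fps G"
    by (rule fps_ext) (simp add: frobenius_fps_nth frobenius.hom_add)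
  show "frobenius_fps (F * G) = frobenius_fps F * frobenius_fps G"
  proof (rule fps_ext)
    fix n
    let ?f = "\<lambda>i. fps_nth (frobenius_fps F) i * fps_nth (frobenius_fps G) (n - i)"
    show "fps_nth (frobenius_fps (F * G)) n = fps_nth (frobenius_fps F * frobenius_fps G) n"
    proof (cases "even n")
      case True
      then obtain k where k: "n = 2 * k" by (rule evenE)
      have "fps_nth (frobenius_fps F * frobenius_fps G) n = (\<Sum>i\<in>{0..n}. ?f i)"
        by (simp add: fps_mult_nth)
      also have "\<dots> = (\<Sum>i\<in>(*) 2 ` {0..k}. ?f i)"
        by (rule sum.mono_neutral_right) (auto simp: k frobenius_fps_nth image_iff elim!: evenE)
      also have "\<dots> = (\<Sum>i\<in>{0..k}. ?f (2 * i))"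
        by (subst sum.reindex) (auto simp: inj_on_def)
      also have "\<dots> = frobenius (\<Sum>i\<in>{0..k}. fps_nth F i * fps_nth G (k - i))"
        unfolding frobenius.hom_sum
        by (intro sum.cong) (simp_all add: k frobenius_fps_nth frobenius.hom_mult flip: right_diff_distrib')
      finally show ?thesis
        by (simp add: k frobenius_fps_nth fps_mult_nth)
    next
      case False
      then have "?f i = 0" if "i \<le> n" for i
        using that by (auto simp: frobenius_fps_nth)
      then show ?thesis
        using False by (simp add: frobenius_fps_nth [of _ n] fps_mult_nth)
    qed
  qed
qed

interpretation frobenius_fps: ring_morphism "frobenius_fps ^^ n" for n
  by (intro ring_morphism_funpow frobenius_fps_hom)

lemma frobenius_fps_funpow_nth:
  "fps_nth ((frobenius_fps ^^ i) F) n
    = (if 2 ^ i dvd n then (frobenius ^^ i) (fps_nth F (n div 2 ^ i)) else 0)"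
proof (induction i arbitrary: n)
  case (Suc i)
  show ?case
  proof (cases "even n")
    case True
    then obtain k where "n = 2 * k" by (rule evenE)
    then show ?thesis by (simp add: frobenius_fps_nth Suc)
  next
    case False
    then show ?thesis by (auto simp: frobenius_fps_nth)
  qed
qed simp

lemma frobenius_fps_funpow_integral:
  "F \<in> integral_fps \<Longrightarrow> (frobenius_fps ^^ i) F \<in> integral_fps"
  by (simp add: integral_fps_def frobenius_fps_funpow_nth frobenius_funpow_integral)

text \<open>Pairs off the diagonal occur twice, so modulo 2 only the diagonal term of a square
  remains.\<close>

lemma fps_square_nth:
  fixes G :: "'a :: comm_ring_1 fps"
  shows "fps_nth (G ^ 2) d = 2 * (\<Sum>i | 2 * i < d. fps_nth G i * fps_nth G (d - i))
    + (if even d then fps_nth G (d div 2) ^ 2 else 0)"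
proof -
  let ?f = "\<lambda>i. fps_nth G i * fps_nth G (d - i)"
  have "{i. 2 * i < d} \<subseteq> {..d}" by auto
  then have fin: "finite {i. 2 * i < d}" by (rule finite_subset) simp
  have "fps_nth (G ^ 2) d = (\<Sum>i\<in>{i. 2 * i < d} \<union> ({i. i \<le> d \<and> d < 2 * i} \<union> {i. 2 * i = d}). ?f i)"
    unfolding power2_eq_square fps_mult_nth by (rule sum.cong) auto
  also have "\<dots> = (\<Sum>i | 2 * i < d. ?f i) + ((\<Sum>i | i \<le> d \<and> d < 2 * i. ?f i) + (\<Sum>i | 2 * i = d. ?f i))"
  proof -
    have "finite {i. i \<le> d \<and> d < 2 * i}" by (rule finite_subset [of _ "{..d}"]) auto
    moreover have "finite {i. 2 * i = d}" by (rule finite_subset [of _ "{..d}"]) auto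
    ultimately show ?thesis
      using fin by (subst sum.union_disjoint, simp, simp, force)+ simp
  qed
  also have "(\<Sum>i | i \<le> d \<and> d < 2 * i. ?f i) = (\<Sum>i | 2 * i < d. ?f i)"
    by (rule sum.reindex_bij_witness [where i = "\<lambda>i. d - i" and j = "\<lambda>i. d - i"]) (auto simp: mult.commute)
  also have "(\<Sum>i | 2 * i = d. ?f i) = (if even d then fps_nth G (d div 2) ^ 2 else 0)"
  proof (cases "even d")
    case True
    then have "{i. 2 * i = d} = {d div 2}" "d - d div 2 = d div 2" by auto
    then show ?thesis using True by (simp add: power2_eq_square)
  next
    case False
    then have "{i. 2 * i = d} = {}" by auto
    then show ?thesis using False by simp
  qed
  finally show ?thesis by simp
qed

text \<open>In odd degrees the left side vanishes and the square has only doubled terms; in even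
  degrees the diagonal term is compared by \<open>frobenius_cong\<close>.\<close>

lemma frobenius_fps_cong_square:
  assumes "G \<in> integral_fps"
  obtains W where "W \<in> integral_fps" "frobenius_fps G = G ^ 2 + 2 * W"
proof -
  have "\<exists>w\<in>integral. fps_nth (frobenius_fps G) d = fps_nth (G ^ 2) d + 2 * w" for d
  proof -
    let ?s = "\<Sum>i | 2 * i < d. fps_nth G i * fps_nth G (d - i)"
    have s: "?s \<in> integral"
      using assms by (intro integral_sum integral_mult) (simp_all add: integral_fps_def)
    show ?thesis
    proof (cases "even d")
      case True
      obtain w where w: "w \<in> integral"
        "frobenius (fps_nth G (d div 2)) = fps_nth G (d div 2) ^ 2 + 2 * w"
        using assms frobenius_cong [of "fps_nth G (d div 2)"] by (auto simp: integral_fps_def)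
      show ?thesis
        by (rule bexI [of _ "w - ?s"])
          (use True w s in \<open>simp_all add: frobenius_fps_nth fps_square_nth integral_diff algebra_simps\<close>)
    next
      case False
      then show ?thesis
        using integral_diff [OF integral_0 s]
        by (intro bexI [of _ "0 - ?s"]) (simp_all add: frobenius_fps_nth fps_square_nth)
    qed
  qed
  then obtain w where w: "\<And>d. w d \<in> integral"
    "\<And>d. fps_nth (frobenius_fps G) d = fps_nth (G ^ 2) d + 2 * w d" by metis
  have "frobenius_fps G = G ^ 2 + 2 * Abs_fps w"
    by (rule fps_ext) (simp add: w numeral_fps_const)
  moreover have "Abs_fps w \<in> integral_fps"
    by (simp add: integral_fps_def w)
  ultimately show ?thesis using that by blast
qed

lemma frobenius_fps_funpow_cong:
  assumes "G \<in> integral_fps"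
  shows "\<exists>W\<in>integral_fps. (frobenius_fps ^^ i) G = G ^ 2 ^ i + 2 * W"
proof (induction i)
  case 0
  show ?case by (rule bexI [of _ 0]) (simp_all add: integral_fps_def)
next
  case (Suc i)
  then obtain V where V: "V \<in> integral_fps" "(frobenius_fps ^^ i) G = G ^ 2 ^ i + 2 * V" by blast
  obtain W where W: "W \<in> integral_fps" "frobenius_fps G = G ^ 2 + 2 * W"
    using frobenius_fps_cong_square [OF assms] .
  have "(frobenius_fps ^^ Suc i) G = (frobenius_fps ^^ i) (G ^ 2 + 2 * W)"
    by (simp add: funpow_swap1 W)
  also have "\<dots> = (G ^ 2 ^ i + 2 * V) ^ 2 + 2 * (frobenius_fps ^^ i) W"
    by (simp add: frobenius_fps.hom_add frobenius_fps.hom_mult frobenius_fps.hom_power V)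
  also have "\<dots> = (G ^ 2 ^ i) ^ 2 + 2 * (2 * V * G ^ 2 ^ i + 2 * V ^ 2 + (frobenius_fps ^^ i) W)"
    by (simp add: power2_eq_square algebra_simps)
  also have "(G ^ 2 ^ i) ^ 2 = G ^ 2 ^ Suc i"
    by (simp add: mult.commute flip: power_mult)
  finally show ?case
    using V W assms
    by (intro bexI [of _ "2 * V * G ^ 2 ^ i + 2 * V ^ 2 + (frobenius_fps ^^ i) W"])
      (auto intro!: integral_fps_add integral_fps_mult integral_fps_power frobenius_fps_funpow_integral)
qed

text \<open>Each squaring gains a factor 2, as (A + 2^(m+1) V)^2 = A^2 + 2^(m+2) (A V + 2^m V^2).
  After m squarings this is one factor more than the denominator of l_m.\<close>

lemma power_two_power_cong:
  assumes "Y \<in> integral_fps" "W \<in> integral_fps"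
  shows "\<exists>V\<in>integral_fps. (Y + 2 * W) ^ 2 ^ m = Y ^ 2 ^ m + 2 ^ Suc m * V"
proof (induction m)
  case 0
  show ?case using assms by auto
next
  case (Suc m)
  then obtain V where V: "V \<in> integral_fps" "(Y + 2 * W) ^ 2 ^ m = Y ^ 2 ^ m + 2 ^ Suc m * V" by blast
  have "(Y + 2 * W) ^ 2 ^ Suc m = ((Y + 2 * W) ^ 2 ^ m) ^ 2"
    by (simp add: mult.commute flip: power_mult)
  also have "\<dots> = (Y ^ 2 ^ m) ^ 2 + 2 ^ Suc (Suc m) * (Y ^ 2 ^ m * V + 2 ^ m * V ^ 2)"
    unfolding V by (simp add: power2_eq_square algebra_simps)
  also have "(Y ^ 2 ^ m) ^ 2 = Y ^ 2 ^ Suc m"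
    by (simp add: mult.commute flip: power_mult)
  finally show ?case
    using V assms
    by (intro bexI [of _ "Y ^ 2 ^ m * V + 2 ^ m * V ^ 2"])
      (auto intro!: integral_fps_add integral_fps_mult integral_fps_power)
qed

text \<open>The top coefficient of F could enter only next to a constant term of F, which is 0. This
  is what makes an induction on d possible: F^k - G^k is the product of a multiple of X^d and a
  series without constant term.\<close>

lemma fps_power_nth_cutoff:
  fixes F :: "'a :: comm_ring_1 fps"
  assumes "fps_nth F 0 = 0" "k \<ge> 2"
  shows "fps_nth (fps_cutoff d F ^ k) d = fps_nth (F ^ k) d"
proof -
  obtain n where n: "k = Suc (Suc n)"
    using assms(2) by (metis add_2_eq_Suc le_Suc_ex)
  let ?G = "fps_cutoff d F"
  let ?S = "\<Sum>i<Suc (Suc n). F ^ i * ?G ^ (Suc n - i)"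
  have "F ^ k - ?G ^ k = (F - ?G) * ?S"
    unfolding n by (rule diff_power_eq_sum)
  also have "F - ?G = fps_X ^ d * fps_shift d F"
    using fps_shift_cutoff' [of d F] by (metis add_diff_cancel_right')
  finally have "fps_nth (F ^ k - ?G ^ k) d = fps_nth (fps_shift d F * ?S) 0"
    by (simp add: mult.assoc fps_X_power_mult_nth)
  moreover have "fps_nth ?S 0 = 0"
    unfolding fps_sum_nth by (rule sum.neutral) (auto simp: assms(1) fps_nth_power_0 power_0_left)
  ultimately show ?thesis by (simp only: fps_mult_nth_0 mult_zero_right fps_sub_nth right_minus_eq)
qed

lemma fps_power_nth_cong:
  fixes F G :: "'a :: comm_ring_1 fps"
  assumes "\<And>j. j \<le> d \<Longrightarrow> fps_nth F j = fps_nth G j"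
  shows "j \<le> d \<Longrightarrow> fps_nth (F ^ k) j = fps_nth (G ^ k) j"
proof (induction k arbitrary: j)
  case (Suc k)
  then show ?case
    using assms by (simp add: fps_mult_nth)
qed simp

text \<open>For an arbitrary monoid the algebra may have zero divisors; cancellation comes from the
  scalar 1/2.\<close>

lemma two_mult_cancel:
  fixes x y :: "'m :: comm_monoid_add \<Rightarrow>\<^sub>0 rat"
  shows "2 * x = 2 * y \<longleftrightarrow> x = y"
proof
  assume "2 * x = 2 * y"
  then have "scalar (1 / 2) * 2 * x = scalar (1 / 2) * 2 * y"
    by (simp add: mult.assoc)
  moreover have "scalar (1 / 2) * 2 = (1 :: 'm \<Rightarrow>\<^sub>0 rat)"
    using mult_single [of "0 :: 'm" "1 / 2 :: rat" 0 2] by simp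
  ultimately show "x = y" by simp
qed simp

text \<open>Write g(t) for the sum of l_n sigma^n(c) t^(2^n); the last hypothesis is log F = g,
  truncated. Both log and g satisfy the functional equation. Modulo twice integral elements,
  (sigma^i log)(F^(2^i)) may be replaced by (sigma^i log)(sigma^i F) = sigma^i g, so subtracting the
  two equations leaves 2 F = 2 c t modulo twice integral elements. The bound N is free because the
  hypothesis is used in degree d and, after sigma^i, in degree d / 2^i with bound d - i.\<close>

lemma functional_equation_integral:
  fixes l u :: "nat \<Rightarrow> ('m :: comm_monoid_add \<Rightarrow>\<^sub>0 rat)" and F :: "('m \<Rightarrow>\<^sub>0 rat) fps"
  assumes l_0: "l 0 = 1"
    and l_integral: "\<And>n. 2 ^ n * l n \<in> integral"
    and u_integral: "\<And>n. n > 0 \<Longrightarrow> u n \<in> integral"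
    and l_eq: "\<And>n. n > 0 \<Longrightarrow> 2 * l n = (\<Sum>i\<in>{1..n}. u i * (frobenius ^^ i) (l (n - i)))"
    and c: "c \<in> integral"
    and F_0: "fps_nth F 0 = 0"
    and log_F: "\<And>d N. d \<le> N \<Longrightarrow> (\<Sum>n\<le>N. l n * fps_nth (F ^ 2 ^ n) d)
      = (\<Sum>n\<le>N. if d = 2 ^ n then l n * (frobenius ^^ n) c else 0)"
  shows "fps_nth F d \<in> integral"
proof (induction d rule: less_induct)
  case (less d)
  show ?case
  proof (cases "d = 0")
    case False
    let ?G = "fps_cutoff d F"
    let ?s = "\<lambda>i m. (frobenius ^^ i) (l m)"
    let ?h = "\<lambda>n. if d = 2 ^ n then l n * (frobenius ^^ n) c else 0"
    let ?h' = "\<lambda>i m. if d = 2 ^ (i + m) then ?s i m * (frobenius ^^ (i + m)) c else 0"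
    have G: "?G \<in> integral_fps"
      using less by (simp add: integral_fps_def)
    \<comment> \<open>The cutoff is integral by the induction hypothesis, so the congruences apply
      to it; they give an error 2^(m+1) V, of which 2^m is used up by the denominator of
      l_m.\<close>
    have "\<exists>w\<in>integral. ?s i m * fps_nth (F ^ 2 ^ (i + m)) d
        = ?s i m * fps_nth (((frobenius_fps ^^ i) F) ^ 2 ^ m) d - 2 * w" if i: "i > 0" for i m
    proof -
      obtain W where W: "W \<in> integral_fps" "(frobenius_fps ^^ i) ?G = ?G ^ 2 ^ i + 2 * W"
        using frobenius_fps_funpow_cong [OF G] by blast
      obtain V where V: "V \<in> integral_fps"
        "(?G ^ 2 ^ i + 2 * W) ^ 2 ^ m = (?G ^ 2 ^ i) ^ 2 ^ m + 2 ^ Suc m * V"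
        using power_two_power_cong [OF integral_fps_power [OF G] W(1)] by blast
      \<comment> \<open>Up to degree d the series sigma^i F involves only coefficients of F of index
        at most d / 2^i, which is below d because i > 0.\<close>
      have "fps_nth (((frobenius_fps ^^ i) F) ^ 2 ^ m) d = fps_nth (((frobenius_fps ^^ i) ?G) ^ 2 ^ m) d"
      proof (rule fps_power_nth_cong [of d])
        fix j assume "j \<le> d"
        moreover have "j div 2 ^ i < j" if "j > 0"
          using that i by (intro div_less_dividend one_less_power) auto
        ultimately have "j div 2 ^ i < d"
          using False by (cases "j = 0") auto
        then show "fps_nth ((frobenius_fps ^^ i) F) j = fps_nth ((frobenius_fps ^^ i) ?G) j"
          by (simp add: frobenius_fps_funpow_nth)
      qed simp
      also have "\<dots> = fps_nth (?G ^ 2 ^ (i + m)) d + 2 ^ Suc m * fps_nth V d"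
        unfolding W V by (simp add: power_add numeral_fps_const fps_const_power flip: power_mult)
      also have "fps_nth (?G ^ 2 ^ (i + m)) d = fps_nth (F ^ 2 ^ (i + m)) d"
      proof (rule fps_power_nth_cutoff [OF F_0])
        have "(2 :: nat) ^ 1 \<le> 2 ^ (i + m)" using i by (intro power_increasing) auto
        then show "(2 :: nat) \<le> 2 ^ (i + m)" by simp
      qed
      finally have "?s i m * fps_nth (F ^ 2 ^ (i + m)) d
          = ?s i m * fps_nth (((frobenius_fps ^^ i) F) ^ 2 ^ m) d
            - 2 * ((frobenius ^^ i) (2 ^ m * l m) * fps_nth V d)"
        by (simp add: frobenius_funpow.hom_mult frobenius_funpow.hom_power algebra_simps)
      moreover have "(frobenius ^^ i) (2 ^ m * l m) * fps_nth V d \<in> integral"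
        using V(1) by (intro integral_mult frobenius_funpow_integral l_integral) (simp add: integral_fps_def)
      ultimately show ?thesis by blast
    qed
    then obtain w where w: "\<And>i m. i > 0 \<Longrightarrow> w i m \<in> integral"
      "\<And>i m. i > 0 \<Longrightarrow> ?s i m * fps_nth (F ^ 2 ^ (i + m)) d
        = ?s i m * fps_nth (((frobenius_fps ^^ i) F) ^ 2 ^ m) d - 2 * w i m"
      by metis
    \<comment> \<open>This is \<open>log_F\<close> in degree k = d / 2^i, transported by sigma^i;
      the estimate i + k <= 2^i k ensures that d - i is an admissible bound.\<close>
    have psi: "(\<Sum>m\<le>d - i. ?s i m * fps_nth (((frobenius_fps ^^ i) F) ^ 2 ^ m) d) = (\<Sum>m\<le>d - i. ?h' i m)"
      if i: "i > 0" "i \<le> d" for i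
    proof (cases "2 ^ i dvd d")
      case True
      then obtain k where k: "d = 2 ^ i * k" by (rule dvdE)
      have "k > 0" using k False by auto
      have "i < 2 ^ i" by (rule less_exp)
      then have "i + k \<le> 2 ^ i * k"
      proof -
        have "Suc i * k \<le> 2 ^ i * k" using Suc_leI [OF \<open>i < 2 ^ i\<close>] by (rule mult_right_mono) simp
        moreover have "i \<le> i * k" using \<open>k > 0\<close> by simp
        ultimately show ?thesis unfolding mult_Suc by linarith
      qed
      then have "k \<le> d - i" using k by simp
      have "(\<Sum>m\<le>d - i. ?s i m * fps_nth (((frobenius_fps ^^ i) F) ^ 2 ^ m) d)
          = (frobenius ^^ i) (\<Sum>m\<le>d - i. l m * fps_nth (F ^ 2 ^ m) k)"
        unfolding frobenius_funpow.hom_sum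
        by (intro sum.cong) (simp_all add: frobenius_fps_funpow_nth k frobenius_funpow.hom_mult
          flip: frobenius_fps.hom_power)
      also have "\<dots> = (\<Sum>m\<le>d - i. ?h' i m)"
        unfolding log_F [OF \<open>k \<le> d - i\<close>] frobenius_funpow.hom_sum
        by (intro sum.cong) (auto simp: k power_add frobenius_funpow.hom_mult funpow_add)
      finally show ?thesis .
    next
      case False
      then have "d \<noteq> 2 ^ (i + m)" for m by (auto simp: power_add)
      then show ?thesis
        using False by (simp add: frobenius_fps_funpow_nth flip: frobenius_fps.hom_power)
    qed
    have split: "{..d} = insert 0 {1..d}" by auto
    have "2 * (\<Sum>n\<le>d. ?h n) = 2 * (\<Sum>n\<le>d. l n * fps_nth (F ^ 2 ^ n) d)"
      using log_F [of d d] by simp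
    also have "\<dots> = 2 * fps_nth F d + (\<Sum>n\<in>{1..d}. 2 * l n * fps_nth (F ^ 2 ^ n) d)"
      unfolding split by (simp add: l_0 sum_distrib_left distrib_left mult.assoc)
    also have "(\<Sum>n\<in>{1..d}. 2 * l n * fps_nth (F ^ 2 ^ n) d)
        = (\<Sum>n\<in>{1..d}. \<Sum>i\<in>{1..n}. u i * (?s i (n - i) * fps_nth (F ^ 2 ^ n) d))"
      by (intro sum.cong) (simp_all add: l_eq sum_distrib_right mult.assoc)
    also have "\<dots> = (\<Sum>i\<in>{1..d}. \<Sum>m\<le>d - i. u i * (?s i m * fps_nth (F ^ 2 ^ (i + m)) d))"
      unfolding sum_triangle_shift by simp
    also have "\<dots> = (\<Sum>i\<in>{1..d}. u i * (\<Sum>m\<le>d - i. ?s i m * fps_nth (((frobenius_fps ^^ i) F) ^ 2 ^ m) d)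
        - 2 * (\<Sum>m\<le>d - i. u i * w i m))"
      by (intro sum.cong) (simp_all add: w sum_distrib_left sum_subtractf algebra_simps)
    also have "\<dots> = (\<Sum>i\<in>{1..d}. \<Sum>m\<le>d - i. u i * ?h' i m) - 2 * (\<Sum>i\<in>{1..d}. \<Sum>m\<le>d - i. u i * w i m)"
      unfolding sum_subtractf sum_distrib_left [of 2]
      by (intro arg_cong2 [of _ _ _ _ minus] sum.cong) (simp_all add: psi sum_distrib_left)
    also have "(\<Sum>i\<in>{1..d}. \<Sum>m\<le>d - i. u i * ?h' i m)
        = (\<Sum>n\<in>{1..d}. \<Sum>i\<in>{1..n}. u i * (if d = 2 ^ n then ?s i (n - i) * (frobenius ^^ n) c else 0))"
      unfolding sum_triangle_shift by (simp only: add_diff_cancel_left')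
    \<comment> \<open>The right side of \<open>log_F\<close> obeys the same functional equation, so
      the u_i sum up again to 2 l_n.\<close>
    also have "\<dots> = (\<Sum>n\<in>{1..d}. 2 * ?h n)"
      by (intro sum.cong) (simp_all add: l_eq sum_distrib_right mult.assoc flip: mult.assoc [of 2])
    \<comment> \<open>Only n = 0 is left over, contributing c in degree 1 and 0 in every other
      degree.\<close>
    finally have "2 * ?h 0 = 2 * (fps_nth F d - (\<Sum>i\<in>{1..d}. \<Sum>m\<le>d - i. u i * w i m))"
      unfolding split by (simp add: sum_distrib_left algebra_simps)
    then have "fps_nth F d = ?h 0 + (\<Sum>i\<in>{1..d}. \<Sum>m\<le>d - i. u i * w i m)"
      unfolding two_mult_cancel by (simp add: eq_diff_eq)
    also have "\<dots> \<in> integral"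
      by (intro integral_add integral_sum integral_mult u_integral w) (auto simp: l_0 c)
    finally show ?thesis .
  qed (simp add: F_0)
qed


section \<open>Integrality of the formal group law\<close>

context
  fixes c :: "'a :: comm_ring_1 fps"
  assumes c_0: "fps_nth c 0 = 0"
begin

lemma fps_compose_nth_bound:
  assumes "n \<le> N"
  shows "fps_nth (a oo c) n = (\<Sum>i\<le>N. fps_nth a i * fps_nth (c ^ i) n)"
  unfolding fps_compose_nth using assms c_0
  by (intro sum.mono_neutral_left) (auto simp: startsby_zero_power_prefix)

text \<open>Both sides are sums over pairs (i, j) weighted by c^(i+j); pairs with i + j > n drop out
  because c has no constant term.\<close>

lemma fps_compose_mult: "(a * b) oo c = (a oo c) * (b oo c)"
proof (rule fps_ext)
  fix n :: nat
  let ?A = "{..n} \<times> {..n}"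
  let ?f = "\<lambda>(i, j). fps_nth a i * fps_nth b j * fps_nth (c ^ (i + j)) n"
  have "fps_nth ((a oo c) * (b oo c)) n
      = (\<Sum>k\<le>n. (\<Sum>i\<le>n. fps_nth a i * fps_nth (c ^ i) k) * (\<Sum>j\<le>n. fps_nth b j * fps_nth (c ^ j) (n - k)))"
    unfolding fps_mult_nth atLeast0AtMost
    by (intro sum.cong) (simp_all add: fps_compose_nth_bound [of _ n])
  also have "\<dots> = (\<Sum>k\<le>n. \<Sum>i\<le>n. \<Sum>j\<le>n. fps_nth a i * fps_nth b j * (fps_nth (c ^ i) k * fps_nth (c ^ j) (n - k)))"
    by (simp add: sum_product mult_ac)
  also have "\<dots> = (\<Sum>i\<le>n. \<Sum>k\<le>n. \<Sum>j\<le>n. fps_nth a i * fps_nth b j * (fps_nth (c ^ i) k * fps_nth (c ^ j) (n - k)))"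
    by (rule sum.swap)
  also have "\<dots> = (\<Sum>i\<le>n. \<Sum>j\<le>n. \<Sum>k\<le>n. fps_nth a i * fps_nth b j * (fps_nth (c ^ i) k * fps_nth (c ^ j) (n - k)))"
    by (intro sum.cong sum.swap refl)
  also have "\<dots> = (\<Sum>x\<in>?A. ?f x)"
    unfolding sum.cartesian_product [symmetric] power_add fps_mult_nth atLeast0AtMost sum_distrib_left
    by simp
  also have "\<dots> = (\<Sum>x\<in>{(i, j). i + j \<le> n}. ?f x)"
  proof (rule sum.mono_neutral_right)
    have "fps_nth (c ^ k) n = 0" if "n < k" for k
      using startsby_zero_power_prefix [OF c_0, of k] that by blast
    then show "\<forall>x\<in>?A - {(i, j). i + j \<le> n}. ?f x = 0" by (auto simp flip: not_less)
  qed auto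
  also have "\<dots> = (\<Sum>k\<le>n. \<Sum>i\<le>k. ?f (i, k - i))"
    unfolding sum.Sigma [OF finite_atMost ballI [OF finite_atMost]]
    by (rule sum.reindex_bij_witness [where i = "\<lambda>(k, i). (i, k - i)" and j = "\<lambda>(i, j). (i + j, i)"]) auto
  also have "\<dots> = fps_nth ((a * b) oo c) n"
    unfolding fps_compose_nth fps_mult_nth atLeast0AtMost sum_distrib_right by simp
  finally show "fps_nth ((a * b) oo c) n = fps_nth ((a oo c) * (b oo c)) n" by simp
qed

lemma fps_compose_power_comm: "(a oo c) ^ k = a ^ k oo c"
  by (induction k) (simp_all add: fps_compose_mult)

end

lemma bp_log_nth_power [simp]: "fps_nth bp_log (2 ^ n) = araki_l n"
  by (auto simp: bp_log_def)

lemma bp_log_nth_eq_0: "(\<And>n. d \<noteq> 2 ^ n) \<Longrightarrow> fps_nth bp_log d = 0"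
  by (simp add: bp_log_def)

lemma bp_exp_0 [simp]: "fps_nth bp_exp 0 = 0"
  by (simp add: bp_exp_def bp_exp_coeff.simps [of 0])

text \<open>The recursion for exp yields only the other composite; log is then cancelled on the
  right.\<close>

lemma bp_log_oo_bp_exp: "bp_log oo bp_exp = fps_X"
proof -
  have "(bp_log oo bp_exp) oo bp_log = fps_X oo bp_log"
    by (subst fps_compose_assoc [symmetric]) (simp_all add: bp_exp_oo_bp_log)
  then show ?thesis
    by (subst (asm) fps_compose_inj_right) simp_all
qed

text \<open>Puts composition with log into the truncated shape of
  \<open>functional_equation_integral\<close>; N < 2^N makes the sum long enough.\<close>

lemma bp_log_compose_nth:
  assumes "fps_nth f 0 = 0" "d \<le> N"
  shows "fps_nth (bp_log oo f) d = (\<Sum>n\<le>N. araki_l n * fps_nth (f ^ 2 ^ n) d)"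
proof -
  have "N < 2 ^ N" by (rule less_exp)
  then have "d \<le> 2 ^ N" using assms(2) by linarith
  then have "fps_nth (bp_log oo f) d = (\<Sum>i\<le>2 ^ N. fps_nth bp_log i * fps_nth (f ^ i) d)"
    using assms(1) by (rule fps_compose_nth_bound [rotated])
  also have "\<dots> = (\<Sum>i\<in>(^) 2 ` {..N}. fps_nth bp_log i * fps_nth (f ^ i) d)"
  proof (rule sum.mono_neutral_right)
    show "\<forall>i\<in>{..2 ^ N} - (^) 2 ` {..N}. fps_nth bp_log i * fps_nth (f ^ i) d = 0"
    proof
      fix i :: nat assume "i \<in> {..2 ^ N} - (^) 2 ` {..N}"
      then have "i \<noteq> 2 ^ n" for n by auto
      then show "fps_nth bp_log i * fps_nth (f ^ i) d = 0"
        by (simp add: bp_log_nth_eq_0)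
    qed
  qed auto
  also have "\<dots> = (\<Sum>n\<le>N. araki_l n * fps_nth (f ^ 2 ^ n) d)"
    by (subst sum.reindex) (auto simp: inj_on_def)
  finally show ?thesis .
qed

lemma (in ring_morphism) fps_power_hom:
  "Abs_fps (\<lambda>n. h (fps_nth F n)) ^ k = Abs_fps (\<lambda>n. h (fps_nth (F ^ k) n))"
  by (induction k) (auto simp: fps_eq_iff fps_mult_nth hom_sum hom_mult)

lemma fps_of_nat_mult_nth: "fps_nth (of_nat m * f) n = of_nat m * fps_nth f n"
  by (simp flip: fps_of_nat)

lemma bp_log_sum_power_nth:
  "fps_nth (fps_nth (bp_log_sum ^ k) b) a
    = (\<Sum>j\<le>k. of_nat (k choose j) * (fps_nth (bp_log ^ j) a * fps_nth (bp_log ^ (k - j)) b))"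
proof -
  let ?M = "Abs_fps (\<lambda>b. fps_const (fps_nth bp_log b))"
  have "?M ^ i = Abs_fps (\<lambda>b. fps_const (fps_nth (bp_log ^ i) b))" for i
    by (rule ring_morphism.fps_power_hom) (unfold_locales, simp_all)
  then show ?thesis
    unfolding bp_log_sum_def binomial_ring
    by (simp add: fps_sum_nth mult.assoc fps_of_nat_mult_nth)
qed

text \<open>With s n the n-th power of a ring element this says that the substitution of s t for t
  commutes with powers.\<close>

lemma fps_scaled_power:
  fixes F :: "'a :: comm_ring_1 fps"
  assumes "s 0 = 1" "\<And>m n. s (m + n) = s m * s n"
  shows "Abs_fps (\<lambda>n. s n * fps_nth F n) ^ k = Abs_fps (\<lambda>n. s n * fps_nth (F ^ k) n)"
proof (induction k)
  case (Suc k)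
  show ?case
  proof (rule fps_ext)
    fix n
    have "s i * fps_nth F i * (s (n - i) * fps_nth (F ^ k) (n - i))
        = s n * (fps_nth F i * fps_nth (F ^ k) (n - i))" if "i \<le> n" for i
      using assms(2) [of i "n - i"] that by (simp add: mult_ac)
    then show "fps_nth (Abs_fps (\<lambda>n. s n * fps_nth F n) ^ Suc k) n
        = fps_nth (Abs_fps (\<lambda>n. s n * fps_nth (F ^ Suc k) n)) n"
      by (simp add: Suc fps_mult_nth sum_distrib_left)
  qed
qed (auto simp: fps_eq_iff assms)

text \<open>
  The substitution \<open>x = s t\<close>, \<open>z = t\<close> turns the formal group law into a power series in \<open>t\<close>
  whose coefficients are polynomials in \<open>s\<close>; the exponent of \<open>s\<close> is the second component of the
  index.
\<close>

definition adjoin_s :: "bpq \<Rightarrow> ((nat \<Rightarrow>\<^sub>0 nat) \<times> nat) \<Rightarrow>\<^sub>0 rat"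
  where "adjoin_s = monomial_extend (\<lambda>m c. Poly_Mapping.single (m, 0) c)"

definition s_power :: "nat \<Rightarrow> ((nat \<Rightarrow>\<^sub>0 nat) \<times> nat) \<Rightarrow>\<^sub>0 rat"
  where "s_power a = Poly_Mapping.single (0, a) 1"

interpretation adjoin_s: monomial_hom "\<lambda>(m :: nat \<Rightarrow>\<^sub>0 nat) c :: rat. Poly_Mapping.single (m, 0 :: nat) c"
  by unfold_locales (simp_all add: single_add mult_single flip: zero_prod_def)

lemma adjoin_s_hom: "ring_morphism adjoin_s"
  unfolding adjoin_s_def by (rule adjoin_s.ring_morphism_axioms)

interpretation adjoin_s_hom: ring_morphism adjoin_s
  by (rule adjoin_s_hom)

lemma s_power_0 [simp]: "s_power 0 = 1"
  by (simp add: s_power_def flip: zero_prod_def)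

lemma s_power_add: "s_power (a + b) = s_power a * s_power b"
  by (simp add: s_power_def mult_single)

lemma adjoin_s_single [simp]: "adjoin_s (Poly_Mapping.single m c) = Poly_Mapping.single (m, 0) c"
  by (simp add: adjoin_s_def adjoin_s.extend_single)

lemma adjoin_s_frobenius: "adjoin_s ((frobenius ^^ i) x) = (frobenius ^^ i) (adjoin_s x)"
proof (induction i)
  case (Suc i)
  have "adjoin_s (frobenius y) = frobenius (adjoin_s y)" for y
    by (induction y rule: monomial_induct) (simp_all add: frobenius.hom_add adjoin_s_hom.hom_add)
  then show ?case by (simp add: Suc)
qed simp

lemma frobenius_s_power: "(frobenius ^^ n) (s_power a) = s_power (2 ^ n * a)"
  by (induction n) (simp_all add: s_power_def mult_2 distrib_right)

text \<open>Distinct powers of s sit on distinct monomials, so the coefficients of x^a z^b with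
  equal total degree can be separated again.\<close>

lemma lookup_adjoin_s:
  "Poly_Mapping.lookup (s_power a * adjoin_s x) (m, a') = (if a = a' then Poly_Mapping.lookup x m else 0)"
  by (induction x rule: monomial_induct)
    (auto simp: s_power_def mult_single lookup_single when_def adjoin_s_hom.hom_add distrib_left lookup_add)

lemma adjoin_s_integral: "x \<in> integral \<Longrightarrow> adjoin_s x \<in> integral"
proof -
  assume x: "x \<in> integral"
  have "0 \<in> range rat_of_z2" by (rule range_eqI [of _ _ 0]) simp
  then show ?thesis
    using x lookup_adjoin_s [of 0 x] by (auto simp: integral_def)
qed

lemma bp_fgl_rat_integral: "bp_fgl_rat a b \<in> integral"
proof -
  let ?x = "Abs_fps (\<lambda>d. s_power d * fps_nth (Abs_fps (\<lambda>d. adjoin_s (fps_nth bp_log d))) d)"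
  let ?z = "Abs_fps (\<lambda>d. adjoin_s (fps_nth bp_log d))"
  define H where "H = ?x + ?z"
  define E where "E = Abs_fps (\<lambda>d. adjoin_s (fps_nth bp_exp d))"
  have H_0: "fps_nth H 0 = 0" by (simp add: H_def)
  have H_power: "fps_nth (H ^ k) d
      = (\<Sum>a\<le>d. s_power a * adjoin_s (fps_nth (fps_nth (bp_log_sum ^ k) (d - a)) a))" for k d
  proof -
    have "fps_nth (H ^ k) d = (\<Sum>j\<le>k. of_nat (k choose j) * (\<Sum>a\<le>d.
        s_power a * adjoin_s (fps_nth (bp_log ^ j) a) * adjoin_s (fps_nth (bp_log ^ (k - j)) (d - a))))"
      unfolding H_def binomial_ring
      unfolding fps_scaled_power [of s_power, OF s_power_0 s_power_add] adjoin_s_hom.fps_power_hom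
      by (simp add: fps_sum_nth mult.assoc fps_of_nat_mult_nth fps_mult_nth [of "Abs_fps _"] atLeast0AtMost)
    also have "\<dots> = (\<Sum>a\<le>d. \<Sum>j\<le>k. s_power a * (of_nat (k choose j) *
        (adjoin_s (fps_nth (bp_log ^ j) a) * adjoin_s (fps_nth (bp_log ^ (k - j)) (d - a)))))"
      unfolding sum_distrib_left by (subst sum.swap) (simp add: mult_ac)
    also have "\<dots> = (\<Sum>a\<le>d. s_power a * adjoin_s (fps_nth (fps_nth (bp_log_sum ^ k) (d - a)) a))"
      by (simp add: bp_log_sum_power_nth adjoin_s_hom.hom_sum adjoin_s_hom.hom_mult sum_distrib_left)
    finally show ?thesis .
  qed
  \<comment> \<open>Here H is log(s t) + log(t). Its coefficient at t^(2^n) is l_n (1 + s^(2^n)) =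
    l_n sigma^n(1 + s), whence the choice of c.\<close>
  have "fps_nth (E oo H) d \<in> integral" for d
  proof (rule functional_equation_integral [where l = "\<lambda>n. adjoin_s (araki_l n)"
        and u = "\<lambda>n. adjoin_s (honda_u n)" and c = "1 + s_power 1"])
    show "2 ^ n * adjoin_s (araki_l n) \<in> integral" for n
      using adjoin_s_integral [OF araki_l_integral [of n]]
      by (simp add: adjoin_s_hom.hom_mult adjoin_s_hom.hom_power)
    show "adjoin_s (honda_u n) \<in> integral" if "n > 0" for n
      by (intro adjoin_s_integral honda_u_integral that)
    show "2 * adjoin_s (araki_l n)
        = (\<Sum>i\<in>{1..n}. adjoin_s (honda_u i) * (frobenius ^^ i) (adjoin_s (araki_l (n - i))))" if "n > 0" for n
      using arg_cong [OF honda_equation [OF that], of adjoin_s]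
      by (simp add: adjoin_s_hom.hom_mult adjoin_s_hom.hom_sum adjoin_s_frobenius)
    show "1 + s_power 1 \<in> integral"
      by (intro integral_add integral_1)
        (auto simp: s_power_def intro!: integral_single range_eqI [of _ _ 1])
    show "fps_nth (E oo H) 0 = 0"
      by (simp add: E_def)
    fix d N :: nat
    assume "d \<le> N"
    \<comment> \<open>Over the enlarged ring, log(exp H) = H is reduced coefficientwise to
      \<open>bp_log_oo_bp_exp\<close>.\<close>
    have "(\<Sum>n\<le>N. adjoin_s (araki_l n) * fps_nth ((E oo H) ^ 2 ^ n) d)
        = (\<Sum>n\<le>N. \<Sum>k\<le>d. adjoin_s (araki_l n * fps_nth (bp_exp ^ 2 ^ n) k) * fps_nth (H ^ k) d)"
      unfolding fps_compose_power_comm [OF H_0] E_def adjoin_s_hom.fps_power_hom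
      by (simp add: fps_compose_nth atLeast0AtMost sum_distrib_left adjoin_s_hom.hom_mult mult.assoc)
    also have "\<dots> = (\<Sum>k\<le>d. adjoin_s (\<Sum>n\<le>N. araki_l n * fps_nth (bp_exp ^ 2 ^ n) k) * fps_nth (H ^ k) d)"
      unfolding adjoin_s_hom.hom_sum sum_distrib_right by (rule sum.swap)
    also have "\<dots> = (\<Sum>k\<le>d. adjoin_s (fps_nth fps_X k) * fps_nth (H ^ k) d)"
      using \<open>d \<le> N\<close> by (intro sum.cong) (simp_all flip: bp_log_compose_nth [OF bp_exp_0] add: bp_log_oo_bp_exp)
    also have "\<dots> = fps_nth H d"
    proof (cases "d = 0")
      case False
      then have "(\<Sum>k\<le>d. adjoin_s (fps_nth fps_X k) * fps_nth (H ^ k) d)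
          = (\<Sum>k\<in>{1}. adjoin_s (fps_nth fps_X k) * fps_nth (H ^ k) d)"
        by (intro sum.mono_neutral_right) auto
      then show ?thesis by simp
    qed (simp add: H_0)
    also have "\<dots> = (\<Sum>n\<le>N. if d = 2 ^ n then adjoin_s (araki_l n) * (frobenius ^^ n) (1 + s_power 1) else 0)"
    proof (cases "\<exists>n. d = 2 ^ n")
      case True
      then obtain n where n: "d = 2 ^ n" by blast
      have "n < 2 ^ n" by (rule less_exp)
      then have "n \<le> N" using \<open>d \<le> N\<close> n by linarith
      have "(\<Sum>i\<le>N. if d = 2 ^ i then adjoin_s (araki_l i) * (frobenius ^^ i) (1 + s_power 1) else 0)
          = (\<Sum>i\<le>N. if n = i then adjoin_s (araki_l i) * (frobenius ^^ i) (1 + s_power 1) else 0)"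
        by (simp add: n)
      then show ?thesis
        using \<open>n \<le> N\<close> by (simp add: n H_def frobenius_funpow.hom_add frobenius_s_power algebra_simps)
    next
      case False
      then show ?thesis by (simp add: H_def bp_log_nth_eq_0)
    qed
    finally show "(\<Sum>n\<le>N. adjoin_s (araki_l n) * fps_nth ((E oo H) ^ 2 ^ n) d)
      = (\<Sum>n\<le>N. if d = 2 ^ n then adjoin_s (araki_l n) * (frobenius ^^ n) (1 + s_power 1) else 0)" .
  qed simp
  moreover have "fps_nth (E oo H) d = (\<Sum>a\<le>d. s_power a * adjoin_s (bp_fgl_rat a (d - a)))" for d
  proof -
    have "fps_nth (E oo H) d = (\<Sum>k\<le>d. \<Sum>a\<le>d. s_power a *
        adjoin_s (fps_nth bp_exp k * fps_nth (fps_nth (bp_log_sum ^ k) (d - a)) a))"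
      by (simp add: fps_compose_nth atLeast0AtMost H_power E_def sum_distrib_left adjoin_s_hom.hom_mult mult_ac)
    also have "\<dots> = (\<Sum>a\<le>d. s_power a * adjoin_s (bp_fgl_rat a (d - a)))"
      by (subst sum.swap) (simp add: bp_fgl_rat_def adjoin_s_hom.hom_sum sum_distrib_left)
    finally show ?thesis .
  qed
  ultimately have "(\<Sum>i\<le>a + b. s_power i * adjoin_s (bp_fgl_rat i (a + b - i))) \<in> integral"
    by metis
  moreover have "Poly_Mapping.lookup (\<Sum>i\<le>a + b. s_power i * adjoin_s (bp_fgl_rat i (a + b - i))) (m, a)
      = Poly_Mapping.lookup (bp_fgl_rat a b) m" for m
    by (simp add: lookup_sum lookup_adjoin_s)
  ultimately show ?thesis
    unfolding integral_def mem_Collect_eq by (metis (lifting))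
qed

text \<open>Integrality turns the \<open>inv\<close> in \<open>bp_fgl\<close> into a genuine
  preimage. Setting z = x makes the binomial coefficients in (log x + log z)^k add up to
  2^k.\<close>

lemma bp_to_bpq_p: "bp_to_bpq (p n) = fps_nth (bp_exp oo (2 * bp_log)) n"
proof -
  have inv: "bp_to_bpq (inv bp_to_bpq (bp_fgl_rat a b)) = bp_fgl_rat a b" for a b
    by (rule f_inv_into_f) (simp add: range_bp_to_bpq bp_fgl_rat_integral)
  have diagonal: "(\<Sum>b\<le>n. fps_nth (fps_nth (bp_log_sum ^ k) b) (n - b)) = fps_nth ((2 * bp_log) ^ k) n" for k
  proof -
    have "(\<Sum>b\<le>n. fps_nth (fps_nth (bp_log_sum ^ k) b) (n - b))
        = (\<Sum>j\<le>k. of_nat (k choose j) * (\<Sum>b\<le>n. fps_nth (bp_log ^ (k - j)) b * fps_nth (bp_log ^ j) (n - b)))"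
      unfolding bp_log_sum_power_nth sum_distrib_left by (subst sum.swap) (simp add: mult_ac)
    also have "\<dots> = (\<Sum>j\<le>k. of_nat (k choose j) * fps_nth (bp_log ^ k) n)"
      by (intro sum.cong) (simp_all flip: fps_mult_nth atLeast0AtMost power_add)
    also have "\<dots> = of_nat (\<Sum>j\<le>k. k choose j) * fps_nth (bp_log ^ k) n"
      by (simp add: sum_distrib_right)
    also have "\<dots> = fps_nth ((2 * bp_log) ^ k) n"
      by (simp add: choose_row_sum power_mult_distrib numeral_fps_const fps_const_power)
    finally show ?thesis .
  qed
  have "bp_to_bpq (p n) = (\<Sum>b\<le>n. bp_fgl_rat (n - b) b)"
    by (simp add: p_def two_series_def bp_fgl_def bp_to_bpq.hom_sum inv)
  also have "\<dots> = (\<Sum>b\<le>n. \<Sum>k\<le>n. fps_nth bp_exp k * fps_nth (fps_nth (bp_log_sum ^ k) b) (n - b))"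
    by (intro sum.cong) (simp_all add: bp_fgl_rat_def)
  also have "\<dots> = (\<Sum>k\<le>n. fps_nth bp_exp k * (\<Sum>b\<le>n. fps_nth (fps_nth (bp_log_sum ^ k) b) (n - b)))"
    unfolding sum_distrib_left by (rule sum.swap)
  finally show ?thesis
    by (simp add: diagonal fps_compose_nth atLeast0AtMost)
qed

text \<open>The form used for computing: a ring homomorphism can be applied to it without knowing
  the coefficients of exp.\<close>

lemma bp_log_two_series: "bp_log oo Abs_fps (\<lambda>n. bp_to_bpq (p n)) = 2 * bp_log"
proof -
  have "Abs_fps (\<lambda>n. bp_to_bpq (p n)) = bp_exp oo (2 * bp_log)"
    by (simp add: bp_to_bpq_p fps_eq_iff)
  then show ?thesis
    by (simp add: fps_compose_assoc bp_log_oo_bp_exp)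
qed


section \<open>Degrees\<close>

definition weight :: "(nat \<Rightarrow>\<^sub>0 nat) \<Rightarrow> int"
  where "weight m = (\<Sum>j\<in>Poly_Mapping.keys m. int (Poly_Mapping.lookup m j) * (2 * (2 ^ (j + 1) - 1)))"

lemma weight_superset:
  assumes "finite S" "Poly_Mapping.keys m \<subseteq> S"
  shows "weight m = (\<Sum>j\<in>S. int (Poly_Mapping.lookup m j) * (2 * (2 ^ (j + 1) - 1)))"
  unfolding weight_def using assms by (intro sum.mono_neutral_left) (auto simp: in_keys_iff)

lemma weight_add: "weight (m + n) = weight m + weight n"
proof -
  let ?S = "Poly_Mapping.keys m \<union> Poly_Mapping.keys n"
  have "Poly_Mapping.keys (m + n) \<subseteq> ?S" by (rule Poly_Mapping.keys_add)
  then show ?thesis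
    by (simp add: weight_superset [of ?S] lookup_add distrib_right sum.distrib)
qed

lemma weight_single: "weight (Poly_Mapping.single j r) = int r * (2 * (2 ^ (j + 1) - 1))"
  by (simp add: weight_superset [of "{j}"])

lemma weight_0 [simp]: "weight 0 = 0"
  by (simp add: weight_def)

lemma weight_ge:
  assumes "Poly_Mapping.lookup m j > 0"
  shows "2 * (2 ^ (j + 1) - 1) \<le> weight m"
proof -
  let ?w = "\<lambda>j. int (Poly_Mapping.lookup m j) * (2 * (2 ^ (j + 1) - 1))"
  have nonneg: "(0 :: int) \<le> 2 * (2 ^ (i + 1) - 1)" for i
    using one_le_power [of "2 :: int" "i + 1"] by simp
  have "1 * (2 * (2 ^ (j + 1) - 1)) \<le> ?w j"
    using assms by (intro mult_right_mono nonneg) simp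
  also have "?w j \<le> weight m"
    unfolding weight_def using assms
    by (intro member_le_sum mult_nonneg_nonneg nonneg) (simp_all add: in_keys_iff)
  finally show ?thesis by simp
qed

definition homogeneous :: "int \<Rightarrow> ((nat \<Rightarrow>\<^sub>0 nat) \<Rightarrow>\<^sub>0 'a :: zero) \<Rightarrow> bool"
  where "homogeneous d x \<longleftrightarrow> (\<forall>m. Poly_Mapping.lookup x m \<noteq> 0 \<longrightarrow> weight m = d)"

lemma bp_homogeneous_iff: "bp_homogeneous d a \<longleftrightarrow> homogeneous d a"
  by (auto simp: bp_homogeneous_def homogeneous_def weight_def in_keys_iff)

lemma homogeneous_0 [simp]: "homogeneous d 0"
  by (simp add: homogeneous_def)

lemma homogeneous_add:
  fixes x y :: "(nat \<Rightarrow>\<^sub>0 nat) \<Rightarrow>\<^sub>0 'a :: comm_monoid_add"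
  shows "homogeneous d x \<Longrightarrow> homogeneous d y \<Longrightarrow> homogeneous d (x + y)"
  unfolding homogeneous_def lookup_add by (metis add.right_neutral)

lemma homogeneous_uminus:
  fixes x :: "(nat \<Rightarrow>\<^sub>0 nat) \<Rightarrow>\<^sub>0 'a :: ab_group_add"
  shows "homogeneous d x \<Longrightarrow> homogeneous d (- x)"
  by (simp add: homogeneous_def)

lemma homogeneous_diff:
  fixes x y :: "(nat \<Rightarrow>\<^sub>0 nat) \<Rightarrow>\<^sub>0 'a :: ab_group_add"
  shows "homogeneous d x \<Longrightarrow> homogeneous d y \<Longrightarrow> homogeneous d (x - y)"
  unfolding diff_conv_add_uminus by (intro homogeneous_add homogeneous_uminus)

lemma homogeneous_sum:
  fixes f :: "'i \<Rightarrow> (nat \<Rightarrow>\<^sub>0 nat) \<Rightarrow>\<^sub>0 'a :: comm_monoid_add"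
  shows "(\<And>i. i \<in> S \<Longrightarrow> homogeneous d (f i)) \<Longrightarrow> homogeneous d (sum f S)"
  by (induction S rule: infinite_finite_induct) (simp_all add: homogeneous_add)

lemma homogeneous_single: "weight m = d \<Longrightarrow> homogeneous d (Poly_Mapping.single m c)"
  by (simp add: homogeneous_def lookup_single when_def)

lemma homogeneous_1 [simp]: "homogeneous 0 (1 :: (nat \<Rightarrow>\<^sub>0 nat) \<Rightarrow>\<^sub>0 'a :: comm_ring_1)"
  using homogeneous_single [of 0 0 "1 :: 'a"] by simp

lemma homogeneous_numeral [simp]: "homogeneous 0 (numeral k :: (nat \<Rightarrow>\<^sub>0 nat) \<Rightarrow>\<^sub>0 'a :: comm_ring_1)"
  using homogeneous_single [of 0 0 "numeral k :: 'a"] by simp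

lemma homogeneous_mult:
  fixes x y :: "(nat \<Rightarrow>\<^sub>0 nat) \<Rightarrow>\<^sub>0 'a :: comm_ring_1"
  assumes "homogeneous d x" "homogeneous d' y" "d + d' = d''"
  shows "homogeneous d'' (x * y)"
  unfolding homogeneous_def
proof safe
  fix m assume "Poly_Mapping.lookup (x * y) m \<noteq> 0"
  then have "m \<in> Poly_Mapping.keys (x * y)" by (simp add: in_keys_iff)
  then obtain a b where "m = a + b" "a \<in> Poly_Mapping.keys x" "b \<in> Poly_Mapping.keys y"
    using keys_mult [of x y] by (auto dest: subsetD)
  then show "weight m = d''"
    using assms by (auto simp: homogeneous_def weight_add in_keys_iff)
qed

lemma homogeneous_power:
  fixes x :: "(nat \<Rightarrow>\<^sub>0 nat) \<Rightarrow>\<^sub>0 'a :: comm_ring_1"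
  assumes "homogeneous d x"
  shows "homogeneous (int k * d) (x ^ k)"
proof (induction k)
  case 0
  show ?case by simp
next
  case (Suc k)
  have "homogeneous (int (Suc k) * d) (x * x ^ k)"
    by (rule homogeneous_mult [OF assms Suc]) (simp add: algebra_simps)
  then show ?case by simp
qed

lemma homogeneous_v: "homogeneous (2 * (2 ^ j - 1)) (bp_to_bpq (v j))"
proof (cases "j = 0")
  case True
  then show ?thesis by simp
next
  case False
  then show ?thesis by (simp add: bp_to_bpq_v homogeneous_single weight_single)
qed

lemma homogeneous_araki_l: "homogeneous (2 * (2 ^ n - 1)) (araki_l n)"
proof (induction n rule: less_induct)
  case (less n)
  show ?case
  proof (cases "n = 0")
    case True
    then show ?thesis by simp
  next
    case False
    have "homogeneous (2 * (2 ^ n - 1)) (araki_l i * bp_to_bpq (v (n - i)) ^ 2 ^ i)" if "i < n" for i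
    proof (rule homogeneous_mult [OF less [OF that] homogeneous_power [OF homogeneous_v]])
      have "(2 :: int) ^ n = 2 ^ i * 2 ^ (n - i)"
        using that by (simp flip: power_add)
      then show "2 * (2 ^ i - 1) + int (2 ^ i) * (2 * (2 ^ (n - i) - 1)) = 2 * (2 ^ n - 1)"
        by (simp add: algebra_simps)
    qed
    then have "homogeneous (2 * (2 ^ n - 1)) (\<Sum>i<n. araki_l i * bp_to_bpq (v (n - i)) ^ 2 ^ i)"
      by (intro homogeneous_sum) simp
    then show ?thesis
      using False unfolding araki_l.simps [of n]
      by (simp add: homogeneous_mult [OF homogeneous_single [of 0 0]])
  qed
qed

text \<open>With the series variable in degree -2, this is homogeneity of degree -w; the logarithm
  has w = 2.\<close>

definition graded :: "int \<Rightarrow> bpq fps \<Rightarrow> bool"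
  where "graded w f \<longleftrightarrow> (\<forall>d. homogeneous (2 * int d - w) (fps_nth f d))"

lemma graded_mult:
  assumes "graded w f" "graded w' g"
  shows "graded (w + w') (f * g)"
  unfolding graded_def fps_mult_nth
proof (intro allI homogeneous_sum)
  fix d i :: nat assume "i \<in> {0..d}"
  then obtain k where "d = i + k" by (auto simp: le_iff_add)
  then show "homogeneous (2 * int d - (w + w')) (fps_nth f i * fps_nth g (d - i))"
    using assms unfolding graded_def by (intro homogeneous_mult [of "2 * int i - w" _ "2 * int k - w'"]) auto
qed

lemma graded_power:
  assumes "graded w f"
  shows "graded (int k * w) (f ^ k)"
proof (induction k)
  case 0
  show ?case by (simp add: graded_def)
next
  case (Suc k)
  then show ?case
    using graded_mult [OF assms Suc] by (simp add: algebra_simps)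
qed

lemma graded_bp_log: "graded 2 bp_log"
  unfolding graded_def
proof
  fix d :: nat
  show "homogeneous (2 * int d - 2) (fps_nth bp_log d)"
  proof (cases "\<exists>n. d = 2 ^ n")
    case True
    then show ?thesis using homogeneous_araki_l by (auto simp: algebra_simps)
  next
    case False
    then show ?thesis by (simp add: bp_log_nth_eq_0)
  qed
qed

lemma homogeneous_bp_exp_coeff: "homogeneous (2 * int n - 2) (bp_exp_coeff n)"
proof (induction n rule: less_induct)
  case (less n)
  have "homogeneous (2 * int n - 2) (bp_exp_coeff i * fps_nth (bp_log ^ i) n)" if "i < n" for i
    using graded_power [OF graded_bp_log, of i]
    by (intro homogeneous_mult [OF less [OF that], of "2 * int n - int i * 2"]) (auto simp: graded_def)
  then have "homogeneous (2 * int n - 2) (\<Sum>i<n. bp_exp_coeff i * fps_nth (bp_log ^ i) n)"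
    by (intro homogeneous_sum) simp
  moreover have "homogeneous (2 * int n - 2) (if n = 1 then 1 else 0 :: bpq)"
    by simp
  ultimately show ?case
    unfolding bp_exp_coeff.simps [of n] by (rule homogeneous_diff [rotated])
qed

lemma homogeneous_bp_to_bpq: "homogeneous d (bp_to_bpq a) \<longleftrightarrow> homogeneous d a"
  unfolding homogeneous_def lookup_bp_to_bpq
  by (metis rat_of_z2_0 rat_of_z2_inject)

lemma homogeneous_p: "homogeneous (2 * int n - 2) (p n)"
proof -
  have "graded 2 (2 * bp_log)"
    using graded_mult [of 0 2 2 bp_log] graded_bp_log
    by (simp add: graded_def numeral_fps_const)
  then have "graded (int k * 2) ((2 * bp_log) ^ k)" for k
    by (rule graded_power)
  then have "homogeneous (2 * int n - 2) (fps_nth bp_exp k * fps_nth ((2 * bp_log) ^ k) n)" for k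
    unfolding graded_def bp_exp_def
    by (intro homogeneous_mult [of "2 * int k - 2" _ "2 * int n - int k * 2"])
      (simp_all add: homogeneous_bp_exp_coeff)
  then show ?thesis
    unfolding homogeneous_bp_to_bpq [symmetric] bp_to_bpq_p fps_compose_nth
    by (intro homogeneous_sum) simp
qed


section \<open>Coefficients of the 2-series\<close>

text \<open>The ring homomorphism to Q that sends v_(j+1) to 1 and every other v_i with i > 0 to
  0.\<close>

definition pure_v :: "nat \<Rightarrow> bpq \<Rightarrow> rat"
  where "pure_v j = monomial_extend (\<lambda>m c. if Poly_Mapping.keys m \<subseteq> {j} then c else 0)"

lemma pure_v_hom: "ring_morphism (pure_v j)"
proof -
  have keys: "Poly_Mapping.keys (m + n) = Poly_Mapping.keys m \<union> Poly_Mapping.keys n"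
    for m n :: "nat \<Rightarrow>\<^sub>0 nat"
    by (auto simp: in_keys_iff lookup_add)
  interpret monomial_hom "\<lambda>(m :: nat \<Rightarrow>\<^sub>0 nat) (c :: rat). if Poly_Mapping.keys m \<subseteq> {j} then c else 0"
    by unfold_locales (auto simp: keys)
  show ?thesis
    unfolding pure_v_def by unfold_locales
qed

interpretation pure_v: ring_morphism "pure_v j" for j
  by (rule pure_v_hom)

lemma pure_v_single: "pure_v j (Poly_Mapping.single m c) = (if Poly_Mapping.keys m \<subseteq> {j} then c else 0)"
  by (cases "c = 0") (simp_all add: pure_v_def monomial_extend_def)

lemma pure_v_scalar [simp]: "pure_v j (scalar c) = c"
  by (simp add: pure_v_single)

lemma pure_v_v: "0 < i \<Longrightarrow> pure_v j (bp_to_bpq (v i)) = (if i = Suc j then 1 else 0)"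
  by (auto simp: bp_to_bpq_v pure_v_single)

lemma pure_monomial: "Poly_Mapping.keys m \<subseteq> {j} \<Longrightarrow> m = Poly_Mapping.single j (Poly_Mapping.lookup m j)"
  by (rule poly_mapping_eqI) (auto simp: lookup_single when_def in_keys_iff)

text \<open>Setting v_(j+1) to 1 loses nothing on homogeneous elements: since its degree is
  positive, the total degree determines its exponent.\<close>

lemma pure_v_homogeneous:
  assumes "homogeneous (int r * (2 * (2 ^ (j + 1) - 1))) x"
  shows "pure_v j x = Poly_Mapping.lookup x (Poly_Mapping.single j r)"
proof -
  let ?k = "Poly_Mapping.single j r"
  have pure: "m = ?k" if "m \<in> Poly_Mapping.keys x" "Poly_Mapping.keys m \<subseteq> {j}" for m
  proof -
    have m: "m = Poly_Mapping.single j (Poly_Mapping.lookup m j)"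
      using that(2) by (rule pure_monomial)
    have "(1 :: int) < 2 ^ (j + 1)" by (rule one_less_power) simp_all
    then have "(2 :: int) * (2 ^ (j + 1) - 1) \<noteq> 0" by simp
    moreover have "weight m = int r * (2 * (2 ^ (j + 1) - 1))"
      using assms that(1) by (simp add: homogeneous_def in_keys_iff)
    moreover have "weight m = int (Poly_Mapping.lookup m j) * (2 * (2 ^ (j + 1) - 1))"
      using arg_cong [OF m, of weight] unfolding weight_single .
    ultimately have r: "Poly_Mapping.lookup m j = r" by simp
    show ?thesis using m unfolding r .
  qed
  have keys: "Poly_Mapping.keys ?k \<subseteq> {j}" by simp
  have "Poly_Mapping.keys m \<subseteq> {j} \<longleftrightarrow> m = ?k" if "m \<in> Poly_Mapping.keys x" for m
    using pure [OF that] keys by metis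
  then have "pure_v j x = (\<Sum>m\<in>Poly_Mapping.keys x. if m = ?k then Poly_Mapping.lookup x m else 0)"
    unfolding pure_v_def monomial_extend_def by (intro sum.cong) simp_all
  also have "\<dots> = Poly_Mapping.lookup x ?k"
    by (simp add: in_keys_iff)
  finally show ?thesis .
qed

lemma pure_v_araki_l:
  assumes "0 < n" "n \<le> Suc j"
  shows "pure_v j (araki_l n) = (if n = Suc j then 1 / (2 - 2 ^ 2 ^ n) else 0)"
  using assms
proof (induction n rule: less_induct)
  case (less n)
  have "pure_v j (araki_l i * bp_to_bpq (v (n - i)) ^ 2 ^ i) = 0" if "i < n" "i \<noteq> 0" for i
    using less that by (simp add: pure_v.hom_mult)
  then have "(\<Sum>i<n. pure_v j (araki_l i * bp_to_bpq (v (n - i)) ^ 2 ^ i))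
      = (\<Sum>i\<in>{0}. pure_v j (araki_l i * bp_to_bpq (v (n - i)) ^ 2 ^ i))"
    using less.prems by (intro sum.mono_neutral_right) auto
  then show ?case
    using less.prems
    by (simp add: araki_l.simps [of n] pure_v.hom_mult pure_v.hom_sum pure_v_v)
qed

section \<open>The 2-series with the single generator v_(j+1) retained and set to 1\<close>

context
  fixes j :: nat and S :: "rat fps" and r :: nat
  defines "S \<equiv> Abs_fps (\<lambda>n. pure_v j (bp_to_bpq (p n)))" and "r \<equiv> 2 ^ Suc j"
begin

lemma pure_two_series_0: "fps_nth S 0 = 0"
  by (simp add: S_def)

text \<open>In this range log S reduces to S + S^r / (2 - 2^r): the l_n with 0 < n <= j specialize
  to 0, and S^(2^n) with n > j + 1 starts in degree at least 2 r.\<close>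

lemma pure_two_series_equation:
  assumes "d < 2 * r"
  shows "fps_nth S d + 1 / (2 - 2 ^ r) * fps_nth (S ^ r) d = 2 * pure_v j (fps_nth bp_log d)"
proof -
  let ?P = "Abs_fps (\<lambda>n. bp_to_bpq (p n))"
  define N where "N = max d (Suc j)"
  have "2 * pure_v j (fps_nth bp_log d) = pure_v j (fps_nth (bp_log oo ?P) d)"
    by (simp add: bp_log_two_series numeral_fps_const pure_v.hom_mult)
  also have "fps_nth (bp_log oo ?P) d = (\<Sum>n\<le>N. araki_l n * fps_nth (?P ^ 2 ^ n) d)"
    by (rule bp_log_compose_nth) (auto simp: N_def)
  also have "pure_v j \<dots> = (\<Sum>n\<le>N. pure_v j (araki_l n) * fps_nth (S ^ 2 ^ n) d)"
    using pure_v.fps_power_hom [of j ?P] by (simp add: S_def pure_v.hom_sum pure_v.hom_mult)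
  also have "\<dots> = (\<Sum>n\<in>{0, Suc j}. pure_v j (araki_l n) * fps_nth (S ^ 2 ^ n) d)"
  proof (rule sum.mono_neutral_right)
    show "\<forall>n\<in>{..N} - {0, Suc j}. pure_v j (araki_l n) * fps_nth (S ^ 2 ^ n) d = 0"
    proof
      fix n assume n: "n \<in> {..N} - {0, Suc j}"
      show "pure_v j (araki_l n) * fps_nth (S ^ 2 ^ n) d = 0"
      proof (cases "n \<le> Suc j")
        case True
        then show ?thesis using n by (simp add: pure_v_araki_l)
      next
        case False
        then have "(2 :: nat) ^ Suc (Suc j) \<le> 2 ^ n" by (intro power_increasing) auto
        then have "d < 2 ^ n" using assms by (simp add: r_def)
        then show ?thesis
          using startsby_zero_power_prefix [OF pure_two_series_0, of "2 ^ n"] by simp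
      qed
    qed
  qed (auto simp: N_def)
  also have "\<dots> = fps_nth S d + 1 / (2 - 2 ^ r) * fps_nth (S ^ r) d"
    by (simp add: pure_v_araki_l r_def)
  finally show ?thesis by simp
qed

lemma two_le_r: "r \<ge> 2"
  unfolding r_def by simp

lemma pure_two_series_1: "fps_nth S 1 = 2"
  using pure_two_series_equation [of 1] two_le_r startsby_zero_power_prefix [OF pure_two_series_0, of r]
  by simp

lemma pure_two_series_gap:
  assumes "1 < d" "d < r"
  shows "fps_nth S d = 0"
proof -
  have "pure_v j (fps_nth bp_log d) = 0"
  proof (cases "\<exists>n. d = 2 ^ n")
    case True
    then obtain n where n: "d = 2 ^ n" by blast
    then have "n < Suc j" "n \<noteq> 0"
      using assms by (auto simp: r_def simp del: power_Suc intro!: Nat.gr0I)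
    then show ?thesis by (simp add: n pure_v_araki_l)
  qed (simp add: bp_log_nth_eq_0)
  then show ?thesis
    using pure_two_series_equation [of d] assms startsby_zero_power_prefix [OF pure_two_series_0, of r]
    by simp
qed

text \<open>The leading coefficient 2 contributes 2^r to S^r, and 2 / (2 - 2^r) - 2^r / (2 - 2^r) =
  1.\<close>

lemma pure_two_series_r: "fps_nth S r = 1"
proof -
  have "fps_nth (S ^ r) r = 2 ^ r"
    using startsby_zero_power_nth_same [OF pure_two_series_0, of r] pure_two_series_1 by simp
  moreover have "pure_v j (fps_nth bp_log r) = 1 / (2 - 2 ^ r)"
    unfolding r_def bp_log_nth_power by (simp add: pure_v_araki_l)
  ultimately have "fps_nth S r + 1 / (2 - 2 ^ r) * 2 ^ r = 2 * (1 / (2 - 2 ^ r))"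
    using pure_two_series_equation [of r] two_le_r by simp
  then have "fps_nth S r = 1 / (2 - 2 ^ r) * (2 - 2 ^ r)"
    unfolding right_diff_distrib eq_diff_eq by (simp only: mult.commute)
  then show ?thesis
    unfolding r_def using pow_pow_neq_two [of "Suc j"] by simp
qed

text \<open>The index 2 r - 1 is where v_(j+1)^2 has the right degree. It is odd and not 1, so log
  has no term there and only S^r contributes.\<close>

lemma pure_two_series_last: "fps_nth S (2 * r - 1) * (2 - 2 ^ r) = - (of_nat r * 2 ^ (r - 1))"
proof -
  \<comment> \<open>By the gap between degrees 1 and r, S agrees with x C through degree r; the
    binomial theorem then gives r 2^(r-1) as the coefficient of x^(r-1) in C^r.\<close>
  define C :: "rat fps" where "C = fps_const 2 + fps_X ^ (r - 1)"
  have r: "r - 1 > 0" "r = Suc (r - 1)" using two_le_r by auto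
  have C_0: "fps_nth (C ^ k) 0 = 2 ^ k" for k
    using r by (simp add: C_def fps_nth_power_0 power_0_left)
  have C: "fps_nth (C ^ Suc k) (r - 1) = of_nat (Suc k) * 2 ^ k" for k
  proof (induction k)
    case 0
    show ?case using r by (simp add: C_def)
  next
    case (Suc k)
    have "fps_nth (C ^ Suc (Suc k)) (r - 1) = 2 * fps_nth (C ^ Suc k) (r - 1) + fps_nth (C ^ Suc k) 0"
      unfolding power_Suc [of C "Suc k"]
      by (subst C_def) (simp add: distrib_right fps_X_power_mult_nth del: power_Suc)
    then show ?case
      unfolding Suc C_0 by (simp add: algebra_simps)
  qed
  have S: "S = fps_X * fps_shift 1 S"
    by (rule fps_ext) (auto simp: pure_two_series_0)
  have "fps_nth (S ^ r) (2 * r - 1) = fps_nth (fps_shift 1 S ^ r) (r - 1)"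
    by (subst S) (use two_le_r in \<open>simp add: power_mult_distrib fps_X_power_mult_nth\<close>)
  also have "\<dots> = fps_nth (C ^ r) (r - 1)"
  proof (rule fps_power_nth_cong [of "r - 1"])
    fix i assume "i \<le> r - 1"
    then consider "i = 0" | "0 < i" "i < r - 1" | "i = r - 1" by linarith
    then show "fps_nth (fps_shift 1 S) i = fps_nth C i"
    proof cases
      case 1
      then show ?thesis using pure_two_series_1 r by (simp add: C_def)
    next
      case 2
      then show ?thesis using pure_two_series_gap [of "i + 1"] by (simp add: C_def)
    next
      case 3
      then show ?thesis using pure_two_series_r r by (simp add: C_def)
    qed
  qed simp
  also have "\<dots> = of_nat r * 2 ^ (r - 1)"
    using C [of "r - 1"] r by simp
  finally have power: "fps_nth (S ^ r) (2 * r - 1) = of_nat r * 2 ^ (r - 1)" .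
  have "pure_v j (fps_nth bp_log (2 * r - 1)) = 0"
  proof -
    have "odd (2 * r - 1)" "2 * r - 1 \<noteq> 1" using two_le_r by auto
    then have "2 * r - 1 \<noteq> 2 ^ n" for n
      by (metis even_numeral even_power gr0I power_0)
    then show ?thesis by (simp add: bp_log_nth_eq_0)
  qed
  moreover have "(2 :: rat) - 2 ^ r \<noteq> 0"
    unfolding r_def by (rule pow_pow_neq_two) simp
  ultimately show ?thesis
    using pure_two_series_equation [of "2 * r - 1"] power two_le_r by (simp add: field_simps)
qed

end

lemma lookup_p_pure:
  assumes "2 * int n - 2 = int r * (2 * (2 ^ (j + 1) - 1))"
  shows "rat_of_z2 (Poly_Mapping.lookup (p n) (Poly_Mapping.single j r)) = pure_v j (bp_to_bpq (p n))"
  using assms homogeneous_p [of n] pure_v_homogeneous [of r j "bp_to_bpq (p n)"]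
  by (simp add: homogeneous_bp_to_bpq lookup_bp_to_bpq)

lemma p_1: "p (Suc 0) = 2"
proof -
  have "bp_to_bpq (p (Suc 0)) = bp_to_bpq 2"
    by (simp add: bp_to_bpq_p fps_compose_nth bp_exp_def bp_exp_coeff.simps [of "Suc 0"] bp_exp_coeff.simps [of 0]
      numeral_fps_const)
  then show ?thesis unfolding inj_eq [OF inj_bp_to_bpq] .
qed

lemma lookup_p_power:
  "Poly_Mapping.lookup (p (2 ^ Suc j)) (Poly_Mapping.single j 1) = 1"
proof -
  have "rat_of_z2 (Poly_Mapping.lookup (p (2 ^ Suc j)) (Poly_Mapping.single j 1)) = rat_of_z2 1"
    using pure_two_series_r [of j] by (subst lookup_p_pure) (simp_all add: algebra_simps)
  then show ?thesis unfolding rat_of_z2_inject .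
qed

text \<open>In r 2^(r-1) / (2 - 2^r) the denominator absorbs one factor 2 only, and the numerator is
  divisible by 4 because r is an even power of 2 or 2 itself, in any case at least 2.\<close>

lemma lookup_p_square:
  "\<exists>c. Poly_Mapping.lookup (p (2 * 2 ^ Suc j - 1)) (Poly_Mapping.single j 2) = 2 * c"
proof -
  define r :: nat where "r = 2 ^ Suc j"
  let ?x = "pure_v j (bp_to_bpq (p (2 * r - 1)))"
  have "r \<ge> 2" by (simp add: r_def)
  then obtain k where k: "r = Suc (Suc k)"
    by (metis add_2_eq_Suc le_Suc_ex)
  have "?x * (2 - 2 ^ r) = - (of_nat r * 2 ^ (r - 1))"
    using pure_two_series_last [of j] by (simp add: r_def)
  also have "of_nat r = 2 * (2 :: rat) ^ j"
    by (simp add: r_def)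
  finally have "2 * (?x * (1 - 2 ^ Suc k)) = 2 * (2 * (- (2 ^ j * 2 ^ k)))"
    by (simp add: k algebra_simps)
  then have "?x * (1 - 2 ^ Suc k) = 2 * (- (2 ^ j * 2 ^ k))"
    by (simp only: mult_cancel_left) simp
  moreover have "odd (1 - 2 ^ Suc k :: int)" by simp
  then have "(of_int (1 - 2 ^ Suc k) :: rat) \<noteq> 0" by (metis even_zero of_int_eq_0_iff)
  then have "(1 - 2 ^ Suc k :: rat) \<noteq> 0" by simp
  ultimately have "?x = 2 * (- (2 ^ j * 2 ^ k)) / (1 - 2 ^ Suc k)"
    by (metis nonzero_eq_divide_eq)
  then have "?x = 2 * (of_int (- (2 ^ j * 2 ^ k)) / of_int (1 - 2 ^ Suc k))"
    by simp
  moreover obtain c where "of_int (- (2 ^ j * 2 ^ k)) / of_int (1 - 2 ^ Suc k) = rat_of_z2 c"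
    using z2_fractionI [OF \<open>odd (1 - 2 ^ Suc k :: int)\<close>] by blast
  ultimately have "?x = rat_of_z2 (2 * c)"
    by (simp add: rat_of_z2.hom_mult)
  moreover have "2 * int (2 * r - 1) - 2 = int 2 * (2 * (2 ^ (j + 1) - 1))"
    using \<open>r \<ge> 2\<close> by (simp add: r_def of_nat_diff)
  ultimately have "rat_of_z2 (Poly_Mapping.lookup (p (2 * r - 1)) (Poly_Mapping.single j 2)) = rat_of_z2 (2 * c)"
    by (simp add: lookup_p_pure)
  then show ?thesis
    unfolding rat_of_z2_inject r_def by blast
qed


section \<open>The 2-series modulo the invariant ideals\<close>

interpretation ring_module: module "(*) :: 'r :: comm_ring_1 \<Rightarrow> 'r \<Rightarrow> 'r"
  by unfold_locales (simp_all add: algebra_simps)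

lemma v_ideal_v: "i < m \<Longrightarrow> x * \<eta> (v i) \<in> v_ideal \<eta> m"
  unfolding v_ideal_def by (intro ring_module.span_scale ring_module.span_base) auto

lemma v_ideal_mult: "y \<in> v_ideal \<eta> m \<Longrightarrow> x * y \<in> v_ideal \<eta> m"
  unfolding v_ideal_def by (rule ring_module.span_scale)

lemma v_ideal_add: "x \<in> v_ideal \<eta> m \<Longrightarrow> y \<in> v_ideal \<eta> m \<Longrightarrow> x + y \<in> v_ideal \<eta> m"
  unfolding v_ideal_def by (rule ring_module.span_add)

lemma v_ideal_sum: "(\<And>i. i \<in> S \<Longrightarrow> f i \<in> v_ideal \<eta> m) \<Longrightarrow> sum f S \<in> v_ideal \<eta> m"
  unfolding v_ideal_def by (rule ring_module.span_sum)

context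
  fixes \<eta> :: "bp \<Rightarrow> 'r :: comm_ring_1" and m :: nat
  assumes \<eta>: "ring_morphism \<eta>" and m: "m > 0"
begin

interpretation \<eta>: ring_morphism \<eta> by (rule \<eta>)

text \<open>Even coefficients are accounted for by v_0 = 2, which lies in the ideal since m > 0;
  index j stands for v_(j+1). The structure map is arbitrary so that underlying classes and
  geometric fixed points are treated at once.\<close>

lemma v_ideal_monomials:
  assumes "\<And>k. Poly_Mapping.lookup a k \<noteq> 0 \<Longrightarrow>
    (\<exists>c. Poly_Mapping.lookup a k = 2 * c) \<or> (\<exists>j. Suc j < m \<and> Poly_Mapping.lookup k j > 0)"
  shows "\<eta> a \<in> v_ideal \<eta> m"
proof -
  have "\<eta> (Poly_Mapping.single k (Poly_Mapping.lookup a k)) \<in> v_ideal \<eta> m"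
    if k: "k \<in> Poly_Mapping.keys a" for k
  proof -
    have "Poly_Mapping.lookup a k \<noteq> 0" using k by (simp add: in_keys_iff)
    from assms [OF this] show ?thesis
    proof
      assume "\<exists>c. Poly_Mapping.lookup a k = 2 * c"
      then obtain c where c: "Poly_Mapping.lookup a k = c * 2" by (auto simp: mult.commute)
      have "Poly_Mapping.single k (Poly_Mapping.lookup a k) = Poly_Mapping.single k c * scalar 2"
        by (simp only: c mult_single add_0_right)
      also have "scalar 2 = v 0" by (simp add: v_def)
      finally have "Poly_Mapping.single k (Poly_Mapping.lookup a k) = Poly_Mapping.single k c * v 0" .
      then show ?thesis
        using m by (simp add: \<eta>.hom_mult v_ideal_v)
    next
      assume "\<exists>j. Suc j < m \<and> Poly_Mapping.lookup k j > 0"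
      then obtain j where j: "Suc j < m" "Poly_Mapping.lookup k j > 0" by blast
      obtain k' where k': "k = k' + Poly_Mapping.single j 1"
      proof (rule that)
        show "k = (k - Poly_Mapping.single j 1) + Poly_Mapping.single j 1"
          using j(2) by (intro poly_mapping_eqI) (auto simp: lookup_add lookup_minus lookup_single when_def)
      qed
      have "Poly_Mapping.single k (Poly_Mapping.lookup a k) = Poly_Mapping.single k' (Poly_Mapping.lookup a k) * v (Suc j)"
        by (simp add: v_def mult_single k')
      then show ?thesis
        using j(1) by (simp add: \<eta>.hom_mult v_ideal_v)
    qed
  qed
  then show ?thesis
    by (subst poly_mapping_sum_single [of a], unfold \<eta>.hom_sum) (rule v_ideal_sum)
qed

text \<open>The upper bound on d is the degree of v_(m+1), so no later generator can occur. A
  monomial free of v_1, ..., v_(m-1) is then a power of v_m, and only the coefficients of such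
  powers need inspection.\<close>

lemma v_ideal_homogeneous:
  assumes a: "homogeneous d a" and d: "0 < d" "d < 2 * (2 ^ Suc m - 1)"
    and pure: "\<And>k r. k = Poly_Mapping.single (m - 1) r \<Longrightarrow> d = int r * (2 * (2 ^ m - 1)) \<Longrightarrow>
      \<exists>c. Poly_Mapping.lookup a k = 2 * c"
  shows "\<eta> a \<in> v_ideal \<eta> m"
proof (rule v_ideal_monomials)
  fix k assume k: "Poly_Mapping.lookup a k \<noteq> 0"
  then have w: "weight k = d" using a by (simp add: homogeneous_def)
  show "(\<exists>c. Poly_Mapping.lookup a k = 2 * c) \<or> (\<exists>j. Suc j < m \<and> Poly_Mapping.lookup k j > 0)"
  proof (cases "\<exists>j. Suc j < m \<and> Poly_Mapping.lookup k j > 0")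
    case False
    have "Poly_Mapping.keys k \<subseteq> {m - 1}"
    proof
      fix j assume "j \<in> Poly_Mapping.keys k"
      then have j: "Poly_Mapping.lookup k j > 0" by (simp add: in_keys_iff)
      then have "\<not> Suc j < m" using False by blast
      moreover have "Suc j < Suc m"
      proof -
        have "2 * (2 ^ (j + 1) - 1) < (2 * (2 ^ Suc m - 1) :: int)"
          using weight_ge [OF j] w d by linarith
        then have "(2 :: int) ^ Suc j < 2 ^ Suc m" by simp
        then show ?thesis by (rule power_less_imp_less_exp [rotated]) simp
      qed
      ultimately show "j \<in> {m - 1}" by simp
    qed
    then have k: "k = Poly_Mapping.single (m - 1) (Poly_Mapping.lookup k (m - 1))"
      by (rule pure_monomial)
    then have "d = int (Poly_Mapping.lookup k (m - 1)) * (2 * (2 ^ m - 1))"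
      using w weight_single [of "m - 1" "Poly_Mapping.lookup k (m - 1)"] m by simp
    with k show ?thesis using pure by blast
  qed blast
qed

lemma two_le_power: "(2 :: int) \<le> 2 ^ m"
  using m power_increasing [of 1 m "2 :: int"] by simp

text \<open>The degree 2 i - 2 is smaller than that of v_m, which leaves only the zeroth power of
  v_m, hence i = 1; and p_1 = 2 is v_0.\<close>

lemma p_below_in_v_ideal:
  assumes "0 < i" "i < 2 ^ m"
  shows "\<eta> (p i) \<in> v_ideal \<eta> m"
proof (cases "i = 1")
  case True
  then show ?thesis
    using v_ideal_v [of 0 m 1 \<eta>] m by (simp add: p_1 v_def)
next
  case False
  have "int i < int (2 ^ m)" using assms(2) by (simp only: of_nat_less_iff)
  then have i: "int i + 1 \<le> 2 ^ m" unfolding of_nat_power of_nat_numeral by linarith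
  show ?thesis
  proof (rule v_ideal_homogeneous [OF homogeneous_p])
    show "0 < 2 * int i - 2" using False assms(1) by simp
    show "2 * int i - 2 < 2 * (2 ^ Suc m - 1)" using i two_le_power by simp
    fix k :: "nat \<Rightarrow>\<^sub>0 nat" and r
    assume r: "2 * int i - 2 = int r * (2 * (2 ^ m - 1))"
    have strict: "2 * a - 2 < 1 * (2 * (b - 1))" if "a + 1 \<le> b" for a b :: int
      using that by simp
    have "int r * (2 * (2 ^ m - 1)) < 1 * (2 * (2 ^ m - 1))"
      unfolding r [symmetric] by (rule strict [OF i])
    then have "r = 0"
      using two_le_power by (subst (asm) mult_less_cancel_right) auto
    then show "\<exists>c. Poly_Mapping.lookup (p i) k = 2 * c"
      using r False assms(1) by simp
  qed
qed

lemma p_power_in_v_ideal: "\<eta> (p (2 ^ m)) - \<eta> (v m) \<in> v_ideal \<eta> m"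
proof -
  have m': "Suc (m - 1) = m" using m by simp
  have "homogeneous (2 * (2 ^ m - 1)) (p (2 ^ m) - v m)"
    using homogeneous_p [of "2 ^ m"] homogeneous_v [of m]
    by (intro homogeneous_diff) (simp_all add: homogeneous_bp_to_bpq algebra_simps)
  then have "\<eta> (p (2 ^ m) - v m) \<in> v_ideal \<eta> m"
  proof (rule v_ideal_homogeneous)
    show "0 < 2 * (2 ^ m - 1 :: int)" "2 * (2 ^ m - 1) < (2 * (2 ^ Suc m - 1) :: int)"
      using two_le_power by simp_all
    fix k :: "nat \<Rightarrow>\<^sub>0 nat" and r
    assume k: "k = Poly_Mapping.single (m - 1) r" and r: "2 * (2 ^ m - 1) = int r * (2 * (2 ^ m - 1))"
    then have "r = 1" using two_le_power m by simp
    then have "Poly_Mapping.lookup (p (2 ^ m) - v m) k = 0"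
      using lookup_p_power [of "m - 1"] m by (simp add: m' k v_def lookup_minus)
    then show "\<exists>c. Poly_Mapping.lookup (p (2 ^ m) - v m) k = 2 * c"
      by (intro exI [of _ 0]) simp
  qed
  then show ?thesis by (simp add: \<eta>.hom_diff)
qed

text \<open>The degree exceeds that of v_m and is at most twice it, so v_m^2 is the only power that
  fits; \<open>lookup_p_square\<close> disposes of it.\<close>

lemma p_above_in_v_ideal:
  assumes "2 ^ m < i" "i < 2 ^ Suc m"
  shows "\<eta> (p i) \<in> v_ideal \<eta> m"
proof (rule v_ideal_homogeneous [OF homogeneous_p])
  have m': "Suc (m - 1) = m" using m by simp
  have "int (2 ^ m) < int i" "int i < int (2 ^ Suc m)" using assms by (simp_all only: of_nat_less_iff)
  then have i: "2 ^ m + 1 \<le> int i" "int i + 1 \<le> 2 * 2 ^ m"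
    unfolding of_nat_power of_nat_numeral of_nat_mult power_Suc by linarith+
  show "0 < 2 * int i - 2" "2 * int i - 2 < 2 * (2 ^ Suc m - 1)"
    using i two_le_power by simp_all
  fix k :: "nat \<Rightarrow>\<^sub>0 nat" and r
  assume k: "k = Poly_Mapping.single (m - 1) r" and r: "2 * int i - 2 = int r * (2 * (2 ^ m - 1))"
  have strict: "1 * (2 * (b - 1)) < 2 * a - 2" if "b + 1 \<le> a" for a b :: int
    using that by simp
  have "1 * (2 * (2 ^ m - 1)) < int r * (2 * (2 ^ m - 1))"
    unfolding r [symmetric] by (rule strict [OF i(1)])
  then have "1 < int r"
    by (rule mult_right_less_imp_less) (use two_le_power in simp)
  moreover have "int r * (2 * (2 ^ m - 1)) < 3 * (2 * (2 ^ m - 1))"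
    unfolding r [symmetric] using i two_le_power by simp
  then have "int r < 3"
    by (rule mult_right_less_imp_less) (use two_le_power in simp)
  ultimately have "r = 2" by simp
  then have "int i = int (2 * 2 ^ m - 1)"
    using r by (simp add: of_nat_diff)
  then have "i = 2 * 2 ^ m - 1" by (simp only: of_nat_eq_iff)
  then show "\<exists>c. Poly_Mapping.lookup (p i) k = 2 * c"
    using lookup_p_square [of "m - 1"] by (simp only: m' k \<open>r = 2\<close>)
qed

end


section \<open>The elements \<open>q\<^sub>i\<close>\<close>

interpretation phi_of_bp: ring_morphism phi_of_bp
  unfolding phi_of_bp_def by (rule scalar_hom)

lemma phi_e_power_add: "phi_e_power (k + l) = phi_e_power k * phi_e_power l"
  by (simp add: phi_e_power_def mult_single)

lemma phi_e_power_0 [simp]: "phi_e_power 0 = 1"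
  by (simp add: phi_e_power_def flip: zero_prod_def)

lemma q_geometric_eq:
  "q_geometric (Suc n) = - (\<Sum>j\<in>{1..n}. phi_e_power (int j - int (Suc n)) * phi_of_bp (p j))"
proof (induction n)
  case (Suc n)
  have "phi_e_power (- 1) * phi_e_power (int j - int (Suc n)) = phi_e_power (int j - int (Suc (Suc n)))" for j
    by (simp flip: phi_e_power_add add: algebra_simps)
  then have shift: "phi_e_power (- 1) * (phi_e_power (int j - int (Suc n)) * x)
      = phi_e_power (int j - int (Suc (Suc n))) * x" for j x
    by (simp only: mult.assoc [symmetric])
  have "q_geometric (Suc (Suc n))
      = - (\<Sum>j\<in>{1..n}. phi_e_power (int j - int (Suc (Suc n))) * phi_of_bp (p j))
        - phi_e_power (- 1) * phi_of_bp (p (Suc n))"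
    by (simp only: q_geometric.simps Suc right_diff_distrib mult_minus_right sum_distrib_left shift)
  then show ?case by simp
qed simp

lemma v_generator_geometric: "v_generator phi_of_bp (int n - 1) (q_geometric (2 ^ n))"
proof (cases n)
  case 0
  then show ?thesis by (simp add: v_generator_def)
next
  case (Suc m)
  define N where "N = (2 ^ n - 1 :: nat)"
  let ?t = "\<lambda>j. phi_e_power (int j - int (Suc N)) * phi_of_bp (p j)"
  \<comment> \<open>The exponent is 2^m - 2^n with m = n - 1; the unit in the definition of a
    generator will be the negative of this power of e.\<close>
  let ?e = "phi_e_power (2 ^ m - int (Suc N))"
  have N: "2 ^ n = Suc N" by (simp add: N_def)
  have m: "2 ^ m \<in> {1..N}"
  proof -
    have "(2 :: nat) ^ m < 2 ^ n" using Suc by simp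
    then show ?thesis by (simp add: N)
  qed
  have "- ?e * - phi_e_power (- (2 ^ m - int (Suc N))) = 1"
    by (simp flip: phi_e_power_add)
  then have unit: "- ?e dvd 1" by (metis dvd_triv_left)
  \<comment> \<open>All these j are below 2^(m+1), on one side of 2^m or the other. For m = 0 the
    ideal is zero, but then N = 1 and no index remains.\<close>
  have "?t j \<in> v_ideal phi_of_bp m" if "j \<in> {1..N} - {2 ^ m}" for j
  proof (rule v_ideal_mult, cases "m = 0")
    case True
    then have "j \<in> {}" using that by (simp add: N_def Suc)
    then show "phi_of_bp (p j) \<in> v_ideal phi_of_bp m" by simp
  next
    case False
    have "j < 2 ^ Suc m" using that by (simp add: N flip: Suc)
    then show "phi_of_bp (p j) \<in> v_ideal phi_of_bp m"
      using that False p_below_in_v_ideal [OF phi_of_bp.ring_morphism_axioms, of m j]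
        p_above_in_v_ideal [OF phi_of_bp.ring_morphism_axioms, of m j]
      by (cases "j < 2 ^ m") auto
  qed
  then have "(\<Sum>j\<in>{1..N} - {2 ^ m}. ?t j) \<in> v_ideal phi_of_bp m"
    by (rule v_ideal_sum)
  moreover have "phi_of_bp (p (2 ^ m)) - phi_of_bp (v m) \<in> v_ideal phi_of_bp m"
  proof (cases "m = 0")
    case True
    then show ?thesis
      using v_ideal_sum [of "{}"] by (simp add: p_1 v_def)
  next
    case False
    then show ?thesis by (intro p_power_in_v_ideal phi_of_bp.ring_morphism_axioms) simp
  qed
  ultimately have "- 1 * ((\<Sum>j\<in>{1..N} - {2 ^ m}. ?t j) + ?e * (phi_of_bp (p (2 ^ m)) - phi_of_bp (v m)))
      \<in> v_ideal phi_of_bp m"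
    by (intro v_ideal_mult v_ideal_add)
  also have "- 1 * ((\<Sum>j\<in>{1..N} - {2 ^ m}. ?t j) + ?e * (phi_of_bp (p (2 ^ m)) - phi_of_bp (v m)))
      = q_geometric (2 ^ n) - (- ?e) * phi_of_bp (v m)"
    unfolding N q_geometric_eq sum.remove [OF finite_atLeastAtMost m] by (simp add: algebra_simps)
  finally show ?thesis
    using unit Suc unfolding v_generator_def by (auto intro!: exI [of _ "- ?e"])
qed

lemma v_generator_underlying: "v_generator (\<lambda>a. a) (int n) (p (2 ^ n))"
proof -
  have id: "ring_morphism (\<lambda>a :: bp. a)" by unfold_locales simp_all
  have "p (2 ^ n) - v n \<in> v_ideal (\<lambda>a. a) n"
  proof (cases "n = 0")
    case True
    then show ?thesis
      using v_ideal_sum [of "{}"] by (simp add: p_1 v_def)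
  next
    case False
    then show ?thesis using p_power_in_v_ideal [OF id, of n] by simp
  qed
  then show ?thesis
    unfolding v_generator_def by (auto intro!: exI [of _ 1])
qed


section \<open>Compatibility over the Tate corner\<close>

lemma tate_of_borel_add: "tate_of_borel (x + y) = tate_of_borel x + tate_of_borel y"
  unfolding tate_of_borel_def by (simp add: plus_tate.abs_eq)

lemma tate_of_borel_mult: "tate_of_borel (x * y) = tate_of_borel x * tate_of_borel y"
  unfolding tate_of_borel_def by (simp add: times_tate.abs_eq)

lemma tate_of_borel_0: "tate_of_borel 0 = 0"
  by (simp add: tate_of_borel_def zero_tate_def)

lemma tate_of_borel_uminus: "tate_of_borel (- x) = - tate_of_borel x"
  unfolding tate_of_borel_def by (simp add: uminus_tate.abs_eq)

lemma tate_of_borel_sum: "tate_of_borel (sum f S) = (\<Sum>i\<in>S. tate_of_borel (f i))"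
  by (induction S rule: infinite_finite_induct) (simp_all add: tate_of_borel_0 tate_of_borel_add)

lemma abs_tate_eqI: "x * e_borel ^ n = y * e_borel ^ m \<Longrightarrow> abs_tate (x, m) = abs_tate (y, n)"
  by (simp add: tate.abs_eq_iff tate_relI [where k = 0])

lemma abs_tate_mult: "abs_tate (x, m) * abs_tate (y, n) = abs_tate (x * y, m + n)"
  by (simp add: times_tate.abs_eq)

lemma borel_of_series_hom: "ring_morphism borel_of_series"
  by unfold_locales (transfer; simp)+

interpretation borel_of_series: ring_morphism borel_of_series
  by (rule borel_of_series_hom)

lemma borel_of_series_two_series: "borel_of_series two_series = 0"
  by transfer simp

text \<open>Multiplied by e^(n+1), the tail of the 2-series becomes [2](e) minus its first n terms,
  and [2](e) is zero in the Borel corner.\<close>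

lemma q_borel_mult_e_power:
  "e_borel ^ Suc n * q_borel (Suc n) = - (\<Sum>j\<in>{1..n}. borel_of_series (fps_const (p j)) * e_borel ^ j)"
proof -
  let ?low = "\<Sum>j\<in>{1..n}. fps_const (p j) * fps_X ^ j"
  have "fps_X ^ Suc n * Abs_fps (\<lambda>k. p (Suc n + k)) = two_series - ?low"
  proof (rule fps_ext)
    fix d
    have "fps_nth ?low d = (\<Sum>j\<in>{1..n}. if d = j then p j else 0)"
      by (simp add: fps_sum_nth fps_X_power_nth if_distrib cong: if_cong)
    then have "fps_nth ?low d = (if d \<in> {1..n} then p d else 0)" by simp
    moreover have "fps_nth two_series d = 0" if "d < Suc n" "d \<notin> {1..n}"
      using that by (cases d) auto
    ultimately show "fps_nth (fps_X ^ Suc n * Abs_fps (\<lambda>k. p (Suc n + k))) d = fps_nth (two_series - ?low) d"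
      unfolding fps_X_power_mult_nth fps_sub_nth by (auto simp: p_def)
  qed
  then have "borel_of_series (fps_X ^ Suc n * Abs_fps (\<lambda>k. p (Suc n + k))) = borel_of_series (two_series - ?low)"
    by simp
  then show ?thesis
    unfolding q_borel_def e_borel_def borel_of_series.hom_diff borel_of_series.hom_mult
      borel_of_series.hom_power borel_of_series.hom_sum borel_of_series_two_series
    by simp
qed

lemma e_power_cancel:
  assumes "j \<le> N"
  shows "abs_tate (1, N) * tate_of_borel (e_borel ^ j) = tate_e_power (int j - int N)"
proof (cases "j = N")
  case True
  then show ?thesis
    by (simp add: tate_of_borel_def tate_e_power_def abs_tate_mult) (rule abs_tate_eqI, simp)
next
  case False
  then have "nat (int N - int j) = N - j" "\<not> int N \<le> int j" using assms by auto
  then show ?thesis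
    using assms by (simp add: tate_of_borel_def tate_e_power_def abs_tate_mult)
      (rule abs_tate_eqI, simp flip: power_add)
qed

definition tate_monomial :: "int \<times> (nat \<Rightarrow>\<^sub>0 nat) \<Rightarrow> bp \<Rightarrow> tate"
  where "tate_monomial kc a = tate_of_borel (borel_of_series (fps_const a)) * tate_e_power (fst kc) *
    (\<Prod>j\<in>Poly_Mapping.keys (snd kc).
      tate_of_borel (borel_of_series (fps_nth bp_fgl (j + 1))) ^ Poly_Mapping.lookup (snd kc) j)"

lemma tate_of_phi_eq: "tate_of_phi = monomial_extend tate_monomial"
  by (rule ext) (simp add: tate_of_phi_def monomial_extend_def tate_monomial_def case_prod_beta)

interpretation tate_monomial: monomial_additive tate_monomial
  by unfold_locales
    (simp add: tate_monomial_def borel_of_series.hom_add tate_of_borel_add distrib_right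
      flip: fps_const_add)

lemma q_geometric_single:
  "q_geometric (Suc n) = (\<Sum>j\<in>{1..n}. Poly_Mapping.single (int j - int (Suc n), 0) (- p j))"
  by (simp add: q_geometric_eq phi_e_power_def phi_of_bp_def mult_single single_uminus flip: sum_negf)

text \<open>As e is invertible in the Tate corner, \<open>q_borel_mult_e_power\<close> can be
  divided by e^(n+1), which gives the closed form of the geometric side. That form contains no b_i,
  so their images never enter.\<close>

lemma tate_of_phi_q: "tate_of_phi (q_geometric (Suc n)) = tate_of_borel (q_borel (Suc n))"
proof -
  let ?c = "\<lambda>j. tate_of_borel (borel_of_series (fps_const (p j)))"
  have "tate_of_borel (q_borel (Suc n))
      = abs_tate (1, Suc n) * tate_of_borel (e_borel ^ Suc n) * tate_of_borel (q_borel (Suc n))"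
    unfolding e_power_cancel [OF order_refl] by (simp add: tate_e_power_def flip: one_tate_def)
  also have "\<dots> = abs_tate (1, Suc n) * tate_of_borel (e_borel ^ Suc n * q_borel (Suc n))"
    by (simp only: tate_of_borel_mult mult.assoc)
  also have "\<dots> = (\<Sum>j\<in>{1..n}. - (?c j * (abs_tate (1, Suc n) * tate_of_borel (e_borel ^ j))))"
    unfolding q_borel_mult_e_power
    by (simp add: tate_of_borel_uminus tate_of_borel_sum tate_of_borel_mult sum_distrib_left sum_negf mult_ac)
  also have "\<dots> = (\<Sum>j\<in>{1..n}. - (?c j * tate_e_power (int j - int (Suc n))))"
    by (intro sum.cong) (simp_all add: e_power_cancel)
  also have "\<dots> = tate_of_phi (q_geometric (Suc n))"
    unfolding q_geometric_single tate_of_phi_eq tate_monomial.extend_sum tate_monomial.extend_single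
    by (simp add: tate_monomial_def borel_of_series.hom_uminus tate_of_borel_uminus flip: fps_const_neg)
  finally show ?thesis by simp
qed

lemma phi_part_iff:
  "x \<in> phi_part d \<longleftrightarrow> (\<forall>k c. homogeneous
    (d + 2 * k - (\<Sum>j\<in>Poly_Mapping.keys c. int (Poly_Mapping.lookup c j) * (2 * int (j + 1) - 2)))
    (Poly_Mapping.lookup x (k, c)))"
  unfolding phi_part_def bp_homogeneous_iff by (auto simp: in_keys_iff)

text \<open>Degrees agree because p_j e^(j-i) has degree (2 j - 2) - 2 (j - i) = 2 i - 2, and so
  does p_(i+k) e^k.\<close>

lemma q_in_pi_C2:
  assumes "i > 0"
  shows "q i \<in> pi_C2 (2 * int i - 2)"
proof -
  obtain n where i: "i = Suc n" using assms gr0_implies_Suc by blast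
  have "homogeneous (2 * int i - 2 + 2 * k
      - (\<Sum>j\<in>Poly_Mapping.keys c. int (Poly_Mapping.lookup c j) * (2 * int (j + 1) - 2)))
      (Poly_Mapping.lookup (q_geometric i) (k, c))" for k c
    unfolding i q_geometric_single lookup_sum lookup_single
  proof (rule homogeneous_sum)
    fix j
    show "homogeneous (2 * int (Suc n) - 2 + 2 * k
      - (\<Sum>j\<in>Poly_Mapping.keys c. int (Poly_Mapping.lookup c j) * (2 * int (j + 1) - 2)))
      (- p j when (int j - int (Suc n), 0) = (k, c))"
      using homogeneous_uminus [OF homogeneous_p [of j]] by (auto simp: when_def)
  qed
  moreover have "\<forall>k. bp_homogeneous (2 * int i - 2 + 2 * int k) (fps_nth (Abs_fps (\<lambda>k. p (i + k))) k)"
  proof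
    fix k
    show "bp_homogeneous (2 * int i - 2 + 2 * int k) (fps_nth (Abs_fps (\<lambda>k. p (i + k))) k)"
      using homogeneous_p [of "i + k"] by (simp add: bp_homogeneous_iff algebra_simps)
  qed
  ultimately show ?thesis
    unfolding pi_C2_def q_def q_borel_def borel_part_def
    using tate_of_phi_q [of n] by (auto simp: phi_part_iff i q_borel_def)
qed

theorem proposition8p10:
  fixes n :: nat
  shows "q (2 ^ n) \<in> pi_C2 (2 * 2 ^ n - 2) \<and>
    v_pair_generator (int n) (int n - 1) (q (2 ^ n))"
proof
  show "q (2 ^ n) \<in> pi_C2 (2 * 2 ^ n - 2)"
    using q_in_pi_C2 [of "2 ^ n"] by simp
  have "underlying (q (2 ^ n)) = p (2 ^ n)"
    by (simp add: underlying_def borel_completion_def q_def q_borel_def borel_res.abs_eq borel_of_series.abs_eq)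
  then show "v_pair_generator (int n) (int n - 1) (q (2 ^ n))"
    by (simp add: v_pair_generator_def geometric_fixed_points_def q_def
      v_generator_underlying v_generator_geometric)
qed

end
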